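(* Let $A\in\overline{\mathcal R}^{\,m\times n}$. Then the ELT row rank of $A$ is equal to the ELT column rank of $A$ and to the ELT submatrix rank of $A$.
   Context: Let $\mathbb F$ be an algebraically closed field. The ELT algebra $\mathcal R=\mathscr R(\mathbb F,\mathbb R)$ is the set of symbols ${}^{[\ell]}a$ with $a\in\mathbb R$ (tangible value) and $\ell\in\mathbb F$ (layer), with multiplication ${}^{[\ell_1]}a_1\cdot{}^{[\ell_2]}a_2={}^{[\ell_1\ell_2]}(a_1+a_2)$ and addition ${}^{[\ell_1]}a_1+{}^{[\ell_2]}a_2$ equal to ${}^{[\ell_1]}a_1$ if $a_1>a_2$, to ${}^{[\ell_2]}a_2$ if $a_1<a_2$, and to ${}^{[\ell_1+\ell_2]}a_1$ if $a_1=a_2$. Put $\overline{\mathcal R}=\mathcal R\cup\{-\infty\}$, where $-\infty$ is a formal element with $-\infty+\alpha=\alpha+(-\infty)=\alpha$ and $-\infty\cdot\alpha=\alpha\cdot(-\infty)=-\infty$ for all $\alpha$. The layer map is $s({}^{[\ell]}a)=\ell$, $s(-\infty)=0$; on vectors $s$ is applied entrywise. Let $\mathcal R^\times=\{{}^{[\ell]}a\in\mathcal R:\ell\ne0\}$. The ELT determinant of a square matrix $B=(b_{i,j})$ of size $r$ is $\det B=\sum_{\sigma\in S_r}{}^{[\operatorname{sign}(\sigma)]}0\cdot b_{1,\sigma(1)}\cdots b_{r,\sigma(r)}$; $B$ is singular if $s(\det B)=0$, and nonsingular otherwise. A family of vectors is linearly dependent if there are finitely many members $v_1,\dots,v_p$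 ($p\ge1$, distinct indices) of the family and $a_1,\dots,a_p\in\mathcal R^\times$ with $s\big(\sum_{i=1}^p a_iv_i\big)=(0,\dots,0)$; otherwise it is linearly independent. The ELT row (resp. column) rank of $A$ is the maximal number of linearly independent rows (resp. columns) of $A$. The ELT submatrix rank of $A$ is the maximal size of a square nonsingular submatrix of $A$, and is $0$ if there is none. *)

theory Defs
  imports
    "HOL-Combinatorics.Permutations"
    "HOL-Computational_Algebra.Polynomial"
    "Jordan_Normal_Form.DL_Submatrix"
begin

text \<open>
  The type \<open>'f elt\<close> is the ELT algebra over \<open>'f\<close> with tangible values in the reals, together with
  the additional element \<open>NegInf\<close>; \<open>Elt l a\<close> is the symbol of layer \<open>l\<close> and tangible value \<open>a\<close>.
  Elements \<open>Elt 0 a\<close> of layer zero are not identified with \<open>NegInf\<close>.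
\<close>

datatype 'f elt = NegInf | Elt 'f real

fun layer :: "'f::zero elt \<Rightarrow> 'f" where
  "layer NegInf = 0"
| "layer (Elt l a) = l"

text \<open>
  The algebra is a commutative semiring, whose zero is \<open>NegInf\<close> and whose one is the symbol of
  layer 1 and tangible value 0.
\<close>

instantiation elt :: (comm_ring_1) comm_semiring_1
begin

definition zero_elt :: "'a elt" where
  "0 = NegInf"

definition one_elt :: "'a elt" where
  "1 = Elt 1 0"

fun plus_elt :: "'a elt \<Rightarrow> 'a elt \<Rightarrow> 'a elt" where
  "NegInf + y = y"
| "Elt l a + NegInf = Elt l a"
| "Elt l a + Elt k b =
    (if a > b then Elt l a else if a < b then Elt k b else Elt (l + k) a)"

fun times_elt :: "'a elt \<Rightarrow> 'a elt \<Rightarrow> 'a elt" where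
  "NegInf * y = NegInf"
| "Elt l a * NegInf = NegInf"
| "Elt l a * Elt k b = Elt (l * k) (a + b)"

instance
proof
  fix x y z :: "'a elt"
  show "x + y + z = x + (y + z)"
    by (cases x; cases y; cases z) (auto simp: add.assoc)
  show "x + y = y + x"
    by (cases x; cases y) (auto simp: add.commute)
  show "0 + x = x"
    by (simp add: zero_elt_def)
  show "x * y * z = x * (y * z)"
    by (cases x; cases y; cases z) (auto simp: ac_simps)
  show "x * y = y * x"
    by (cases x; cases y) (auto simp: ac_simps)
  show "1 * x = x"
    by (cases x) (auto simp: one_elt_def)
  show "(x + y) * z = x * z + y * z"
    by (cases x; cases y; cases z) (auto simp: algebra_simps)
  show "0 * x = 0"
    by (simp add: zero_elt_def)
  show "x * 0 = 0"
    by (cases x) (auto simp: zero_elt_def)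
  show "(0 :: 'a elt) \<noteq> 1"
    by (simp add: zero_elt_def one_elt_def)
qed

end

definition elt_times_set :: "'f::zero elt set" where
  "elt_times_set = {Elt l a | l a. l \<noteq> 0}"

text \<open>
  The constant \<open>det\<close> of \<open>Jordan_Normal_Form\<close> needs entries in a ring, hence the separate
  definition: the sign of a permutation enters as a layer.
\<close>

definition elt_det :: "'f::comm_ring_1 elt mat \<Rightarrow> 'f elt" where
  "elt_det B = (\<Sum>p | p permutes {0..<dim_row B}.
     Elt (of_int (sign p)) 0 * (\<Prod>i = 0..<dim_row B. B $$ (i, p i)))"

definition elt_singular :: "'f::comm_ring_1 elt mat \<Rightarrow> bool" where
  "elt_singular B \<longleftrightarrow> layer (elt_det B) = 0"

text \<open>
  Families are indexed, so equal vectors at different indices count as different members.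
  The vectors \<open>v i\<close> are meant to have dimension \<open>n\<close>.
\<close>

definition elt_lin_dep :: "nat \<Rightarrow> ('i \<Rightarrow> 'f::comm_ring_1 elt vec) \<Rightarrow> 'i set \<Rightarrow> bool" where
  "elt_lin_dep n v I \<longleftrightarrow>
    (\<exists>S a. finite S \<and> S \<noteq> {} \<and> S \<subseteq> I \<and> (\<forall>i\<in>S. a i \<in> elt_times_set) \<and>
       map_vec layer (finsum_vec TYPE('f elt) n (\<lambda>i. a i \<cdot>\<^sub>v v i) S) = 0\<^sub>v n)"

definition elt_row_rank :: "'f::comm_ring_1 elt mat \<Rightarrow> nat" where
  "elt_row_rank A =
    Max {card I | I. I \<subseteq> {0..<dim_row A} \<and> \<not> elt_lin_dep (dim_col A) (row A) I}"

definition elt_col_rank :: "'f::comm_ring_1 elt mat \<Rightarrow> nat" where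
  "elt_col_rank A =
    Max {card J | J. J \<subseteq> {0..<dim_col A} \<and> \<not> elt_lin_dep (dim_row A) (col A) J}"

definition elt_submatrix_rank :: "'f::comm_ring_1 elt mat \<Rightarrow> nat" where
  "elt_submatrix_rank A =
    Max (insert 0 {r. 0 < r \<and> (\<exists>I J. I \<subseteq> {0..<dim_row A} \<and> J \<subseteq> {0..<dim_col A} \<and>
           card I = r \<and> card J = r \<and> \<not> elt_singular (submatrix A I J))})"

end

theory Submission
  imports
    Defs
    "HOL-Combinatorics.Cycles"
    "Jordan_Normal_Form.Determinant"
begin

text \<open>
  The theorem follows from one criterion: the rows of a matrix with \<open>m\<close> rows are dependent if and only
  if all its minors of order \<open>m\<close> are singular. Applied to all sets of rows, and through
  transposition to all sets of columns, it says that independent sets of \<open>r\<close> rows, independent sets of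
  \<open>r\<close> columns and nonsingular submatrices of size \<open>r\<close> exist for the same numbers \<open>r\<close>.

  The bridge to linear algebra over the field of layers are potentials. If reals \<open>\<alpha> i\<close>, \<open>\<beta> j\<close> satisfy
  \<open>b i j \<le> \<beta> j - \<alpha> i\<close> for the tangible values of a square matrix, its determinant has value at
  most \<open>\<Sum>\<beta> - \<Sum>\<alpha>\<close>, and its layer at that value is the determinant of the matrix of layers of
  those entries that attain their bound (\<open>layer_at_edet\<close>). Duality for the assignment
  problem provides potentials for which the determinant attains this value
  (\<open>edet_tight_potentials\<close>). With such potentials, the dominant coefficients of a dependence of the rows
  form a left kernel vector of an invertible matrix if the determinant is nonsingular; this is
  the easy direction (\<open>dependent_rows_singular\<close>).

  For the converse (\<open>dependent_rows_if_minors_singular\<close>) the number of rows is reduced by replacing two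
  rows by a combination \<open>x r + y s\<close>. Let \<open>u\<close> and \<open>v\<close> be the minors of order \<open>m - 1\<close> on a choice of
  columns that contain \<open>r\<close> respectively \<open>s\<close> and all other rows. The corresponding minor of the smaller matrix is
  \<open>x u + y v\<close>, so coefficients are needed that annihilate all pairs \<open>(u, v)\<close> simultaneously. For this it
  suffices that \<open>u v' - u' v\<close> is singular for any two pairs (\<open>two_row_dependence\<close>).

  The latter is the heart of the proof (\<open>minor_pairs_proportional\<close>). A potential \<open>\<alpha>\<close> on the rows of a
  rectangular matrix determines the kernel of the matrix of layers of those entries that are maximal in
  their column after shifting the rows by \<open>\<alpha>\<close>. If this kernel is trivial for some \<open>\<alpha>\<close>, Cramer's rule
  gives a nonsingular minor of order \<open>m\<close>. Two disproportionate pairs yield two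
  potentials that agree on \<open>r\<close> and \<open>s\<close> and whose kernels satisfy linearly independent conditions on the
  coordinates of \<open>r\<close> and \<open>s\<close>. Since kernel vectors at the minimum of two potentials restrict to kernel
  vectors at either of them (\<open>initial_kernel_restrict\<close>), the kernel at the minimum is
  trivial.
\<close>

section \<open>Layers at a prescribed tangible value\<close>

text \<open>
  Sums of elements whose tangible values are at most \<open>c\<close> may be computed, as far as the layer at the
  value \<open>c\<close> is concerned, in the base ring: terms of smaller value contribute nothing, whatever
  their layers. The pair \<open>bounded_by\<close>, \<open>layer_at\<close> makes this precise; it behaves like the
  passage from a filtered ring to its graded pieces and turns statements about dominant terms
  into linear algebra. Elements of layer 0 keep their value, so \<open>has_value\<close> is a separate
  predicate and cannot be replaced by \<open>layer_at c x \<noteq> 0\<close>.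
\<close>

fun bounded_by :: "real \<Rightarrow> 'f elt \<Rightarrow> bool" where
  "bounded_by c NegInf = True"
| "bounded_by c (Elt l a) = (a \<le> c)"

fun has_value :: "real \<Rightarrow> 'f elt \<Rightarrow> bool" where
  "has_value c NegInf = False"
| "has_value c (Elt l a) = (a = c)"

fun layer_at :: "real \<Rightarrow> 'f::zero elt \<Rightarrow> 'f" where
  "layer_at c NegInf = 0"
| "layer_at c (Elt l a) = (if a = c then l else 0)"

lemma bounded_by_zero [simp]: "bounded_by c (0 :: 'f::comm_ring_1 elt)"
  by (simp add: zero_elt_def)

lemma layer_zero [simp]: "layer (0 :: 'f::comm_ring_1 elt) = 0"
  by (simp add: zero_elt_def)

lemma layer_at_zero [simp]: "layer_at c (0 :: 'f::comm_ring_1 elt) = 0"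
  by (simp add: zero_elt_def)

lemma layer_mult: "layer (x * y) = layer x * layer (y :: 'f::comm_ring_1 elt)"
  by (cases x; cases y) auto

lemma layer_one [simp]: "layer (1 :: 'f::comm_ring_1 elt) = 1"
  by (simp add: one_elt_def)

lemma elt_times_set_iff: "x \<in> elt_times_set \<longleftrightarrow> layer x \<noteq> 0"
  by (cases x) (auto simp: elt_times_set_def)

lemma layer_at_has_value: "has_value c x \<Longrightarrow> layer_at c x = layer x"
  by (cases x) auto

lemma layer_at_not_has_value: "\<not> has_value c x \<Longrightarrow> layer_at c x = 0"
  by (cases x) auto

lemma layer_zero_layer_at: "layer x = 0 \<Longrightarrow> layer_at c x = 0"
  by (cases x) auto

lemma bounded_by_add:
  "bounded_by c x \<Longrightarrow> bounded_by c y \<Longrightarrow> bounded_by c (x + y :: 'f::comm_ring_1 elt)"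
  by (cases x; cases y) auto

lemma layer_at_add:
  "bounded_by c x \<Longrightarrow> bounded_by c y \<Longrightarrow>
    layer_at c (x + y) = layer_at c x + layer_at c (y :: 'f::comm_ring_1 elt)"
  by (cases x; cases y) auto

lemma has_value_add:
  "has_value c x \<Longrightarrow> bounded_by c y \<Longrightarrow> has_value c (x + y :: 'f::comm_ring_1 elt)"
  by (cases x; cases y) auto

lemma bounded_by_mult:
  "bounded_by c x \<Longrightarrow> bounded_by d y \<Longrightarrow> bounded_by (c + d) (x * y :: 'f::comm_ring_1 elt)"
  by (cases x; cases y) auto

lemma layer_at_mult:
  "bounded_by c x \<Longrightarrow> bounded_by d y \<Longrightarrow>
    layer_at (c + d) (x * y) = layer_at c x * layer_at d (y :: 'f::comm_ring_1 elt)"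
  by (cases x; cases y) auto

lemma has_value_mult:
  "has_value c x \<Longrightarrow> has_value d y \<Longrightarrow> has_value (c + d) (x * y :: 'f::comm_ring_1 elt)"
  by (cases x; cases y) auto

lemma bounded_by_sum:
  "(\<And>i. i \<in> I \<Longrightarrow> bounded_by c (f i)) \<Longrightarrow> bounded_by c (\<Sum>i\<in>I. f i :: 'f::comm_ring_1 elt)"
  by (induction I rule: infinite_finite_induct) (auto intro: bounded_by_add)

lemma layer_at_sum:
  "(\<And>i. i \<in> I \<Longrightarrow> bounded_by c (f i)) \<Longrightarrow>
    layer_at c (\<Sum>i\<in>I. f i :: 'f::comm_ring_1 elt) = (\<Sum>i\<in>I. layer_at c (f i))"
  by (induction I rule: infinite_finite_induct) (auto simp: layer_at_add bounded_by_sum)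

text \<open>
  Layers may cancel in a sum, values never do: this is what makes the value of a determinant
  equal to the optimum of an assignment problem even when the determinant is singular.
\<close>

lemma has_value_sum:
  fixes f :: "'i \<Rightarrow> 'f::comm_ring_1 elt"
  assumes "finite I" "\<And>i. i \<in> I \<Longrightarrow> bounded_by c (f i)" "k \<in> I" "has_value c (f k)"
  shows "has_value c (\<Sum>i\<in>I. f i)"
  using assms by (auto simp: sum.remove[of I k] intro!: has_value_add bounded_by_sum)

lemma bounded_by_prod:
  fixes f :: "'i \<Rightarrow> 'f::comm_ring_1 elt"
  assumes "finite I" "\<And>i. i \<in> I \<Longrightarrow> bounded_by (c i) (f i)"
  shows "bounded_by (\<Sum>i\<in>I. c i) (\<Prod>i\<in>I. f i)"
  using assms by (induction I) (auto simp: one_elt_def intro: bounded_by_mult)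

lemma layer_at_prod:
  fixes f :: "'i \<Rightarrow> 'f::comm_ring_1 elt"
  assumes "finite I" "\<And>i. i \<in> I \<Longrightarrow> bounded_by (c i) (f i)"
  shows "layer_at (\<Sum>i\<in>I. c i) (\<Prod>i\<in>I. f i) = (\<Prod>i\<in>I. layer_at (c i) (f i))"
  using assms
  by (induction I) (auto simp: one_elt_def layer_at_mult bounded_by_prod)

lemma has_value_prod:
  fixes f :: "'i \<Rightarrow> 'f::comm_ring_1 elt"
  assumes "finite I" "\<And>i. i \<in> I \<Longrightarrow> has_value (c i) (f i)"
  shows "has_value (\<Sum>i\<in>I. c i) (\<Prod>i\<in>I. f i)"
  using assms by (induction I) (auto simp: one_elt_def intro: has_value_mult)

lemma layer_sum_elt_zero:
  "layer x = 0 \<Longrightarrow> layer y = 0 \<Longrightarrow> layer (x + y :: 'f::comm_ring_1 elt) = 0"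
  by (cases x; cases y) auto

lemma permutes_nat_less: "p permutes {0..<n} \<Longrightarrow> i < n \<Longrightarrow> p i < (n :: nat)"
  using permutes_in_image[of p "{0..<n}" i] by simp

section \<open>Determinants of matrices given by functions\<close>

abbreviation fdet :: "nat \<Rightarrow> (nat \<Rightarrow> nat \<Rightarrow> 'f::comm_ring_1) \<Rightarrow> 'f" where
  "fdet n f \<equiv> det (mat n n (\<lambda>(i, j). f i j))"

abbreviation edet :: "nat \<Rightarrow> (nat \<Rightarrow> nat \<Rightarrow> 'f::comm_ring_1 elt) \<Rightarrow> 'f elt" where
  "edet n b \<equiv> elt_det (mat n n (\<lambda>(i, j). b i j))"

lemma fdet_expand:
  "fdet n f = (\<Sum>p | p permutes {0..<n}. signof p * (\<Prod>i = 0..<n. f i (p i)))"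
proof -
  have "fdet n f = (\<Sum>p | p permutes {0..<n}. signof p *
      (\<Prod>i = 0..<n. mat n n (\<lambda>(i, j). f i j) $$ (i, p i)))"
    by (rule det_def') simp
  also have "\<dots> = (\<Sum>p | p permutes {0..<n}. signof p * (\<Prod>i = 0..<n. f i (p i)))"
  proof (rule sum.cong[OF refl])
    fix p assume "p \<in> {p. p permutes {0..<n}}"
    then have "p i < n" if "i < n" for i using permutes_nat_less that by blast
    then show "signof p * (\<Prod>i = 0..<n. mat n n (\<lambda>(i, j). f i j) $$ (i, p i)) =
      signof p * (\<Prod>i = 0..<n. f i (p i))" by simp
  qed
  finally show ?thesis .
qed

lemma edet_expand:
  "edet n b = (\<Sum>p | p permutes {0..<n}. Elt (of_int (sign p)) 0 * (\<Prod>i = 0..<n. b i (p i)))"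
  unfolding elt_det_def dim_row_mat
proof (rule sum.cong[OF refl])
  fix p assume "p \<in> {p. p permutes {0..<n}}"
  then have "p i < n" if "i < n" for i using permutes_nat_less that by blast
  then show "Elt (of_int (sign p)) 0 * (\<Prod>i = 0..<n. mat n n (\<lambda>(i, j). b i j) $$ (i, p i)) =
    Elt (of_int (sign p)) 0 * (\<Prod>i = 0..<n. b i (p i))" by simp
qed

lemma fdet_cong:
  "(\<And>i j. i < n \<Longrightarrow> j < n \<Longrightarrow> f i j = g i j) \<Longrightarrow> fdet n f = fdet n g"
  by (rule arg_cong[where f = det]) auto

lemma edet_cong:
  "(\<And>i j. i < n \<Longrightarrow> j < n \<Longrightarrow> f i j = g i j) \<Longrightarrow> edet n f = edet n g"
  by (rule arg_cong[where f = elt_det]) auto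

lemma edet_transpose: "edet n (\<lambda>i j. b j i) = edet n b"
proof -
  have "edet n (\<lambda>i j. b j i) =
      (\<Sum>p | p permutes {0..<n}. Elt (of_int (sign (inv_into UNIV p))) 0 * (\<Prod>i = 0..<n. b (inv_into UNIV p i) i))"
    unfolding edet_expand by (rule sum_permutations_inverse)
  also have "\<dots> = edet n b"
    unfolding edet_expand
  proof (intro sum.cong refl arg_cong2[where f = "(*)"])
    fix p assume "p \<in> {p. p permutes {0..<n}}"
    then have p: "p permutes {0..<n}" by simp
    then show "Elt (of_int (sign (inv_into UNIV p))) 0 = (Elt (of_int (sign p)) 0 :: 'a elt)"
      using sign_inverse[of p] p permutation_permutes by fastforce
    show "(\<Prod>i = 0..<n. b (inv_into UNIV p i) i) = (\<Prod>i = 0..<n. b i (p i))"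
      by (subst prod.permute[OF p]) (simp add: o_def permutes_inverses(2)[OF p])
  qed
  finally show ?thesis .
qed

lemma edet_permute_columns:
  assumes q: "q permutes {0..<n}"
  shows "edet n (\<lambda>i j. b i (q j)) = Elt (of_int (sign q)) 0 * edet n b"
proof -
  have "edet n b = (\<Sum>p | p permutes {0..<n}.
      Elt (of_int (sign (q \<circ> p))) 0 * (\<Prod>i = 0..<n. b i ((q \<circ> p) i)))"
    unfolding edet_expand by (rule setum_permutations_compose_left[OF q])
  also have "\<dots> = (\<Sum>p | p permutes {0..<n}. Elt (of_int (sign q)) 0 *
      (Elt (of_int (sign p)) 0 * (\<Prod>i = 0..<n. b i (q (p i)))))"
  proof (intro sum.cong refl)
    fix p assume "p \<in> {p. p permutes {0..<n}}"
    then have "sign (q \<circ> p) = sign q * sign p"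
      using q by (intro sign_compose) (auto intro: permutes_imp_permutation)
    then have "Elt (of_int (sign (q \<circ> p))) 0 = Elt (of_int (sign q)) 0 * (Elt (of_int (sign p)) 0 :: 'a elt)"
      by simp
    then show "Elt (of_int (sign (q \<circ> p))) 0 * (\<Prod>i = 0..<n. b i ((q \<circ> p) i)) =
      Elt (of_int (sign q)) 0 * (Elt (of_int (sign p)) 0 * (\<Prod>i = 0..<n. b i (q (p i))))"
      by (simp only: mult.assoc o_apply)
  qed
  finally have "edet n b = Elt (of_int (sign q)) 0 * edet n (\<lambda>i j. b i (q j))"
    by (simp only: edet_expand sum_distrib_left)
  moreover have "Elt (of_int (sign q)) 0 * Elt (of_int (sign q)) 0 = (1 :: 'a elt)"
    by (simp add: one_elt_def sign_def)
  ultimately show ?thesis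
    by (simp only: mult.assoc[symmetric] mult_1)
qed

lemma fdet_linear_last_row:
  fixes r s :: "nat \<Rightarrow> 'f::comm_ring_1"
  shows "fdet (Suc k) (\<lambda>i j. if i < k then f i j else x * r j + y * s j) =
    x * fdet (Suc k) (\<lambda>i j. if i < k then f i j else r j) +
    y * fdet (Suc k) (\<lambda>i j. if i < k then f i j else s j)"
  unfolding fdet_expand by (simp add: sum_distrib_left sum.distrib[symmetric] algebra_simps)

lemma edet_linear_last_row:
  fixes r s :: "nat \<Rightarrow> 'f::comm_ring_1 elt"
  shows "edet (Suc k) (\<lambda>i j. if i < k then f i j else x * r j + y * s j) =
    x * edet (Suc k) (\<lambda>i j. if i < k then f i j else r j) +
    y * edet (Suc k) (\<lambda>i j. if i < k then f i j else s j)"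
  unfolding edet_expand by (simp add: sum_distrib_left sum.distrib[symmetric] algebra_simps)

lemma fdet_left_kernel:
  fixes f :: "nat \<Rightarrow> nat \<Rightarrow> 'f::field"
  assumes "\<And>j. j < n \<Longrightarrow> (\<Sum>i<n. z i * f i j) = 0" and "i0 < n" "z i0 \<noteq> 0"
  shows "fdet n f = 0"
proof -
  let ?A = "mat n n (\<lambda>(i, j). f i j)"
  have "det (transpose_mat ?A) = 0"
  proof (subst det_0_iff_vec_prod_zero_field[where n = n], simp, intro exI conjI)
    show "vec n z \<in> carrier_vec n" by simp
    show "vec n z \<noteq> 0\<^sub>v n" using assms(2,3) by (metis index_vec index_zero_vec(1))
    show "transpose_mat ?A *\<^sub>v vec n z = 0\<^sub>v n"
      using assms(1) by (auto simp: scalar_prod_def atLeast0LessThan mult.commute)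
  qed
  then show ?thesis using det_transpose[of ?A n] by simp
qed

text \<open>
  Cramer's rule. If some minor of order \<open>m - 1\<close> on the first \<open>m - 1\<close> rows does not vanish,
  bordering it by a variable column and expanding along that column gives the kernel vector.
\<close>

lemma left_kernel_if_minors_vanish:
  fixes f :: "nat \<Rightarrow> 'c \<Rightarrow> 'f::field"
  assumes "\<And>g. (\<forall>i<m. g i \<in> C) \<Longrightarrow> fdet m (\<lambda>i j. f i (g j)) = 0"
  shows "\<exists>z. (\<exists>i<m. z i \<noteq> 0) \<and> (\<forall>j\<in>C. (\<Sum>i<m. z i * f i j) = 0)"
  using assms
proof (induction m)
  case 0
  then show ?case by (simp add: fdet_expand)
next
  case (Suc k)
  show ?case
  proof (cases "\<forall>g. (\<forall>i<k. g i \<in> C) \<longrightarrow> fdet k (\<lambda>i j. f i (g j)) = 0")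
    case True
    then obtain z where z: "\<exists>i<k. z i \<noteq> 0" "\<forall>j\<in>C. (\<Sum>i<k. z i * f i j) = 0"
      using Suc.IH by blast
    show ?thesis
      by (rule exI[of _ "z(k := 0)"]) (use z in \<open>auto simp: less_Suc_eq\<close>)
  next
    case False
    then obtain g where g: "\<forall>i<k. g i \<in> C" "fdet k (\<lambda>i j. f i (g j)) \<noteq> 0" by blast
    define M where "M = (\<lambda>c. mat (Suc k) (Suc k) (\<lambda>(i, j). f i ((g(k := c)) j)))"
    define z where "z = (\<lambda>i. cofactor (M undefined) i k)"
    have del: "mat_delete (M c) i k = mat_delete (M undefined) i k" for c i
      by (rule eq_matI) (auto simp: M_def mat_delete_def)
    have "(\<Sum>i<Suc k. z i * f i c) = 0" if "c \<in> C" for c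
    proof -
      have "det (M c) = 0"
        unfolding M_def using Suc.prems[of "g(k := c)"] g(1) that by (simp add: less_Suc_eq)
      moreover have "det (M c) = (\<Sum>i<Suc k. M c $$ (i, k) * cofactor (M c) i k)"
        by (rule laplace_expansion_column) (auto simp: M_def)
      moreover have "M c $$ (i, k) = f i c" "cofactor (M c) i k = z i" if "i < Suc k" for i
        using that by (simp add: M_def) (simp only: z_def cofactor_def del[of c])
      ultimately show ?thesis by (simp add: mult.commute)
    qed
    moreover have "z k \<noteq> 0"
    proof -
      have "mat_delete (M undefined) k k = mat k k (\<lambda>(i, j). f i (g j))"
        by (rule eq_matI) (auto simp: M_def mat_delete_def)
      then show ?thesis using g(2) by (simp add: z_def cofactor_def)
    qed
    ultimately show ?thesis by blast
  qed
qed

section \<open>Potentials for the assignment problem\<close>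

text \<open>
  The Egervary duality theorem: the optimum of an assignment problem is certified by potentials
  on rows and columns. The potentials are a solution of a system of difference constraints, and
  such a system is solvable by shortest walks as soon as no closed walk has negative cost.
\<close>

fun walk_cost :: "(nat \<Rightarrow> nat \<Rightarrow> real) \<Rightarrow> nat list \<Rightarrow> real" where
  "walk_cost c (x # y # zs) = c x y + walk_cost c (y # zs)"
| "walk_cost c _ = 0"

lemma walk_cost_append:
  "walk_cost c (xs @ y # ys) = walk_cost c (xs @ [y]) + walk_cost c (y # ys)"
proof (induction xs)
  case Nil
  then show ?case by (cases ys) auto
next
  case (Cons x xs)
  then show ?case by (cases xs) auto
qed

lemma walk_cost_sum:
  "walk_cost c (x # xs) = (\<Sum>k<length xs. c ((x # xs) ! k) (xs ! k))"
proof (induction xs arbitrary: x)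
  case (Cons y ys)
  show ?case using Cons[of y] by (simp add: sum.lessThan_Suc_shift del: sum.lessThan_Suc)
qed simp

lemma closed_walk_nonneg:
  fixes c :: "nat \<Rightarrow> nat \<Rightarrow> real"
  assumes diag: "\<And>i. i < n \<Longrightarrow> c i i = 0"
    and perm: "\<And>p. p permutes {0..<n} \<Longrightarrow> 0 \<le> (\<Sum>i = 0..<n. c i (p i))"
    and "xs \<noteq> []" "set xs \<subseteq> {0..<n}"
  shows "0 \<le> walk_cost c (xs @ [hd xs])"
  using assms(3,4)
proof (induction xs rule: measure_induct_rule[where f = length])
  case (less xs)
  show ?case
  proof (cases "distinct xs")
    case True
    let ?p = "cycle_of_list xs"
    have rot: "map ?p xs = tl xs @ [hd xs]"
      using cyclic_rotation[OF True, of 1] less.prems(1) by (simp add: rotate1_hd_tl)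
    have "?p permutes {0..<n}"
      using cycle_permutes[of xs] less.prems(2) by (rule permutes_subset)
    then have "0 \<le> (\<Sum>i = 0..<n. c i (?p i))" by (rule perm)
    also have "\<dots> = (\<Sum>i\<in>set xs. c i (?p i))"
    proof (rule sum.mono_neutral_right)
      show "\<forall>i\<in>{0..<n} - set xs. c i (?p i) = 0"
        using diag by (auto simp: id_outside_supp)
    qed (use less.prems(2) in auto)
    also have "\<dots> = (\<Sum>k<length xs. c (xs ! k) (?p (xs ! k)))"
      using sum.reindex_bij_betw[OF bij_betw_nth[OF True refl refl], of "\<lambda>i. c i (?p i)"] by simp
    also have "\<dots> = walk_cost c (hd xs # map ?p xs)"
      unfolding walk_cost_sum
    proof (intro sum.cong)
      fix k assume k: "k \<in> {..<length (map ?p xs)}"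
      have "hd xs # map ?p xs = xs @ [hd xs]"
        by (simp only: rot append_Cons[symmetric] hd_Cons_tl[OF less.prems(1)])
      then show "c (xs ! k) (?p (xs ! k)) = c ((hd xs # map ?p xs) ! k) (map ?p xs ! k)"
        using k by (simp add: nth_append)
    qed simp
    also have "hd xs # map ?p xs = xs @ [hd xs]"
      by (simp only: rot append_Cons[symmetric] hd_Cons_tl[OF less.prems(1)])
    finally show ?thesis .
  next
    case False
    \<comment> \<open>A repeated vertex splits the closed walk into two shorter ones.\<close>
    then obtain as y bs cs where xs: "xs = as @ [y] @ bs @ [y] @ cs"
      using not_distinct_decomp by blast
    have "0 \<le> walk_cost c ((y # bs) @ [hd (y # bs)])"
      using less.prems xs by (intro less.IH) auto
    moreover have "0 \<le> walk_cost c ((as @ [y] @ cs) @ [hd (as @ [y] @ cs)])"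
      using less.prems xs by (intro less.IH) auto
    moreover have "hd (as @ [y] @ cs) = hd xs" using xs by (cases as) auto
    ultimately show ?thesis
      unfolding xs using walk_cost_append[of c as y "bs @ y # cs @ [hd xs]"]
        walk_cost_append[of c "y # bs" y "cs @ [hd xs]"] walk_cost_append[of c as y "cs @ [hd xs]"]
      by (simp add: xs)
  qed
qed

text \<open>
  The infimum of the costs of all walks that end in \<open>k\<close> is a solution. It is finite because closing
  a walk by one edge costs a bounded amount and yields a closed walk, of nonnegative cost.
\<close>

lemma difference_constraints_solvable:
  fixes c :: "nat \<Rightarrow> nat \<Rightarrow> real"
  assumes diag: "\<And>i. i < n \<Longrightarrow> c i i = 0"
    and perm: "\<And>p. p permutes {0..<n} \<Longrightarrow> 0 \<le> (\<Sum>i = 0..<n. c i (p i))"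
  shows "\<exists>a. \<forall>i<n. \<forall>k<n. a k \<le> a i + c i k"
proof -
  define W where "W = (\<lambda>k. {walk_cost c (xs @ [k]) | xs. set xs \<subseteq> {0..<n}})"
  have W_nonempty: "W k \<noteq> {}" for k unfolding W_def by (auto intro!: exI[of _ "[]"])
  have lower: "- (\<Sum>i<n. \<bar>c k i\<bar>) \<le> walk_cost c (xs @ [k])" if "set xs \<subseteq> {0..<n}" "k < n" for k xs
  proof (cases "xs = []")
    case True
    then show ?thesis by (simp add: sum_nonneg)
  next
    case False
    have "0 \<le> walk_cost c ((xs @ [k]) @ [hd (xs @ [k])])"
      by (rule closed_walk_nonneg[where c = c, OF diag perm]) (use that in auto)
    also have "\<dots> = walk_cost c (xs @ [k]) + c k (hd xs)"
      using walk_cost_append[of c xs k "[hd xs]"] False by simp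
    also have "c k (hd xs) \<le> (\<Sum>i<n. \<bar>c k i\<bar>)"
    proof -
      have "hd xs \<in> {..<n}" using hd_in_set[OF False] that(1) by auto
      then have "\<bar>c k (hd xs)\<bar> \<le> (\<Sum>i<n. \<bar>c k i\<bar>)" by (intro member_le_sum) auto
      then show ?thesis by linarith
    qed
    finally show ?thesis by simp
  qed
  have bdd: "bdd_below (W k)" if "k < n" for k
    by (rule bdd_belowI[where m = "- (\<Sum>i<n. \<bar>c k i\<bar>)"]) (use lower that in \<open>auto simp: W_def\<close>)
  have "Inf (W k) \<le> Inf (W i) + c i k" if ik: "i < n" "k < n" for i k
  proof -
    have "Inf (W k) - c i k \<le> Inf (W i)"
    proof (rule cInf_greatest[OF W_nonempty])
      fix x assume "x \<in> W i"
      then obtain xs where xs: "x = walk_cost c (xs @ [i])" "set xs \<subseteq> {0..<n}"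
        unfolding W_def by auto
      have "walk_cost c ((xs @ [i]) @ [k]) \<in> W k"
        unfolding W_def using xs(2) ik(1) by (auto intro!: exI[of _ "xs @ [i]"])
      then have "Inf (W k) \<le> walk_cost c ((xs @ [i]) @ [k])"
        by (rule cInf_lower) (rule bdd[OF ik(2)])
      also have "\<dots> = x + c i k"
        using walk_cost_append[of c xs i "[k]"] xs(1) by simp
      finally show "Inf (W k) - c i k \<le> x" by simp
    qed
    then show ?thesis by simp
  qed
  then show ?thesis by (intro exI[of _ "\<lambda>k. Inf (W k)"] allI impI)
qed

text \<open>
  The constraints on the row potentials say that reassigning the column of row \<open>i\<close> to row \<open>k\<close> does
  not pay. Summed over a permutation of the rows they compare the optimal assignment with
  another one.
\<close>

lemma optimal_assignment_potentials:
  fixes w :: "nat \<Rightarrow> nat \<Rightarrow> real"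
  assumes p: "p permutes {0..<n}"
    and opt: "\<And>q. q permutes {0..<n} \<Longrightarrow> (\<Sum>i = 0..<n. w i (q i)) \<le> (\<Sum>i = 0..<n. w i (p i))"
  shows "\<exists>a b. (\<forall>i<n. \<forall>j<n. w i j \<le> b j - a i) \<and> (\<forall>i<n. w i (p i) = b (p i) - a i)"
proof -
  let ?ip = "inv_into UNIV p"
  have ip: "?ip permutes {0..<n}" by (rule permutes_inv[OF p])
  have "\<exists>a. \<forall>i<n. \<forall>k<n. a k \<le> a i + (w i (p i) - w k (p i))"
  proof (rule difference_constraints_solvable)
    fix q assume q: "q permutes {0..<n}"
    have "(\<Sum>i = 0..<n. w (q i) (p i)) = (\<Sum>k = 0..<n. w k ((p \<circ> inv_into UNIV q) k))"
      by (subst sum.permute[OF q]) (simp add: o_def permutes_inverses(2)[OF q])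
    also have "\<dots> \<le> (\<Sum>i = 0..<n. w i (p i))"
      by (intro opt permutes_compose permutes_inv q p)
    finally show "0 \<le> (\<Sum>i = 0..<n. w i (p i) - w (q i) (p i))"
      by (simp add: sum_subtractf)
  qed simp
  then obtain a where a: "\<forall>i<n. \<forall>k<n. a k \<le> a i + (w i (p i) - w k (p i))" ..
  show ?thesis
  proof (intro exI conjI allI impI)
    let ?b = "\<lambda>j. a (?ip j) + w (?ip j) j"
    fix i assume i: "i < n"
    show "w i (p i) = ?b (p i) - a i"
      by (simp add: permutes_inverses(2)[OF p])
    fix j assume j: "j < n"
    have "a i \<le> a (?ip j) + (w (?ip j) (p (?ip j)) - w i (p (?ip j)))"
      using a i permutes_nat_less[OF ip j] by blast
    then show "w i j \<le> ?b j - a i"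
      by (simp add: permutes_inverses(1)[OF p])
  qed
qed

fun tangible_value :: "'f elt \<Rightarrow> real" where
  "tangible_value NegInf = 0"
| "tangible_value (Elt l a) = a"

lemma tight_potentials:
  fixes b :: "nat \<Rightarrow> nat \<Rightarrow> 'f elt"
  assumes r: "r permutes {0..<n}" and fin: "\<And>i. i < n \<Longrightarrow> b i (r i) \<noteq> NegInf"
  shows "\<exists>\<alpha> \<beta> p. p permutes {0..<n} \<and> (\<forall>i<n. \<forall>j<n. bounded_by (\<beta> j - \<alpha> i) (b i j)) \<and>
    (\<forall>i<n. has_value (\<beta> (p i) - \<alpha> i) (b i (p i)))"
proof -
  let ?v = "\<lambda>i j. tangible_value (b i j)"
  define K where "K = (\<Sum>i = 0..<n. \<Sum>j = 0..<n. \<bar>?v i j\<bar>)"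
  \<comment> \<open>The entries without a value get one so low that no optimal assignment can use them.\<close>
  define w where "w = (\<lambda>i j. if b i j = NegInf then - (2 * K + 1) else ?v i j)"
  have K: "(\<Sum>i = 0..<n. \<bar>?v i (p i)\<bar>) \<le> K" if "p permutes {0..<n}" for p
    unfolding K_def
  proof (rule sum_mono)
    fix i assume "i \<in> {0..<n}"
    then show "\<bar>?v i (p i)\<bar> \<le> (\<Sum>j = 0..<n. \<bar>?v i j\<bar>)"
      using permutes_nat_less[OF that, of i]
        member_le_sum[of "p i" "{0..<n}" "\<lambda>j. \<bar>?v i j\<bar>"] by simp
  qed
  have K0: "0 \<le> K" unfolding K_def by (intro sum_nonneg) simp
  let ?S = "\<lambda>p. \<Sum>i = 0..<n. w i (p i)"
  let ?P = "{p. p permutes {0..<n}}"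
  have "finite (?S ` ?P)" "?S ` ?P \<noteq> {}" using r by (auto simp: finite_permutations)
  then have "Max (?S ` ?P) \<in> ?S ` ?P" and max: "\<And>q. q \<in> ?P \<Longrightarrow> ?S q \<le> Max (?S ` ?P)"
    by (rule Max_in, intro Max_ge imageI)
  then obtain p where p: "p permutes {0..<n}" and Sp: "Max (?S ` ?P) = ?S p" by auto
  have opt: "?S q \<le> ?S p" if "q permutes {0..<n}" for q
    using max[of q] that unfolding Sp by simp
  \<comment> \<open>The given finite assignment keeps the optimum above what a penalised entry would allow.\<close>
  have "- K \<le> ?S r"
  proof -
    have "?S r = (\<Sum>i = 0..<n. ?v i (r i))" using fin by (simp add: w_def)
    also have "\<dots> \<ge> - (\<Sum>i = 0..<n. \<bar>?v i (r i)\<bar>)"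
      unfolding sum_negf[symmetric] by (intro sum_mono) simp
    finally show ?thesis using K[OF r] by linarith
  qed
  then have low: "- K \<le> ?S p" using opt[OF r] by linarith
  have finp: "b i (p i) \<noteq> NegInf" if "i < n" for i
  proof
    assume inf: "b i (p i) = NegInf"
    have "?S p = w i (p i) + (\<Sum>k\<in>{0..<n} - {i}. w k (p k))"
      using that by (intro sum.remove) auto
    moreover have "(\<Sum>k\<in>{0..<n} - {i}. w k (p k)) \<le> (\<Sum>k\<in>{0..<n} - {i}. \<bar>?v k (p k)\<bar>)"
      using K0 by (intro sum_mono) (auto simp: w_def)
    moreover have "(\<Sum>k\<in>{0..<n} - {i}. \<bar>?v k (p k)\<bar>) \<le> (\<Sum>k = 0..<n. \<bar>?v k (p k)\<bar>)"
      by (intro sum_mono2) auto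
    moreover have "w i (p i) = - (2 * K + 1)" using inf by (simp add: w_def)
    ultimately show False using low K0 K[OF p] by linarith
  qed
  have "\<exists>\<alpha> \<beta>. (\<forall>i<n. \<forall>j<n. w i j \<le> \<beta> j - \<alpha> i) \<and> (\<forall>i<n. w i (p i) = \<beta> (p i) - \<alpha> i)"
    by (rule optimal_assignment_potentials[of p n w]) (fact p, rule opt)
  then obtain \<alpha> \<beta> where ab: "\<forall>i<n. \<forall>j<n. w i j \<le> \<beta> j - \<alpha> i"
    "\<forall>i<n. w i (p i) = \<beta> (p i) - \<alpha> i"
    by (elim exE conjE)
  have "bounded_by (\<beta> j - \<alpha> i) (b i j)" if "i < n" "j < n" for i j
    using ab(1)[rule_format, OF that] by (cases "b i j") (simp_all add: w_def)
  moreover have "has_value (\<beta> (p i) - \<alpha> i) (b i (p i))" if "i < n" for i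
    using ab(2)[rule_format, OF that] finp[OF that] by (cases "b i (p i)") (simp_all add: w_def)
  ultimately show ?thesis
    by (intro exI[of _ \<alpha>] exI[of _ \<beta>] exI[of _ p] conjI allI impI p) simp_all
qed

section \<open>The determinant at its top value\<close>

lemma sum_permuted_potentials:
  fixes \<alpha> \<beta> :: "nat \<Rightarrow> real"
  assumes "p permutes {0..<n}"
  shows "(\<Sum>i = 0..<n. \<beta> (p i) - \<alpha> i) = (\<Sum>i<n. \<beta> i) - (\<Sum>i<n. \<alpha> i)"
  using sum.permute[OF assms, of \<beta>] by (simp add: sum_subtractf o_def atLeast0LessThan)

text \<open>
  Under potentials with \<open>b i j \<le> \<beta> j - \<alpha> i\<close>, every product in the expansion of the determinant is
  bounded by the same number, so at that value the determinant is an ordinary determinant of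
  layers.
\<close>

lemma
  fixes b :: "nat \<Rightarrow> nat \<Rightarrow> 'f::comm_ring_1 elt"
  assumes "\<And>i j. i < n \<Longrightarrow> j < n \<Longrightarrow> bounded_by (\<beta> j - \<alpha> i) (b i j)"
  shows bounded_by_edet: "bounded_by ((\<Sum>j<n. \<beta> j) - (\<Sum>i<n. \<alpha> i)) (edet n b)" (is "bounded_by ?W _")
    and layer_at_edet: "layer_at ((\<Sum>j<n. \<beta> j) - (\<Sum>i<n. \<alpha> i)) (edet n b) =
      fdet n (\<lambda>i j. layer_at (\<beta> j - \<alpha> i) (b i j))"
proof -
  let ?t = "\<lambda>p. \<Prod>i = 0..<n. b i (p i)"
  have entry: "bounded_by (\<beta> (p i) - \<alpha> i) (b i (p i))" if "p permutes {0..<n}" "i \<in> {0..<n}" for p i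
    using that(2) assms permutes_nat_less[OF that(1)] by simp
  have prod: "bounded_by ?W (?t p)"
    "layer_at ?W (?t p) = (\<Prod>i = 0..<n. layer_at (\<beta> (p i) - \<alpha> i) (b i (p i)))"
    if "p permutes {0..<n}" for p
    using bounded_by_prod[of "{0..<n}" "\<lambda>i. \<beta> (p i) - \<alpha> i" "\<lambda>i. b i (p i)"]
      layer_at_prod[of "{0..<n}" "\<lambda>i. \<beta> (p i) - \<alpha> i" "\<lambda>i. b i (p i)"]
      entry[OF that] sum_permuted_potentials[OF that, of \<beta> \<alpha>] by simp_all
  have bnd: "bounded_by ?W (Elt (of_int (sign p)) 0 * ?t p)" if "p permutes {0..<n}" for p
    using bounded_by_mult[of 0 "Elt (of_int (sign p)) 0" ?W "?t p"] prod(1)[OF that] by simp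
  then show "bounded_by ?W (edet n b)"
    unfolding edet_expand by (intro bounded_by_sum) simp
  have "layer_at ?W (edet n b) =
      (\<Sum>p | p permutes {0..<n}. layer_at ?W (Elt (of_int (sign p)) 0 * ?t p))"
    unfolding edet_expand by (intro layer_at_sum) (simp add: bnd)
  also have "\<dots> = fdet n (\<lambda>i j. layer_at (\<beta> j - \<alpha> i) (b i j))"
    unfolding fdet_expand
  proof (intro sum.cong refl)
    fix p assume "p \<in> {p. p permutes {0..<n}}"
    then have p: "p permutes {0..<n}" by simp
    show "layer_at ?W (Elt (of_int (sign p)) 0 * ?t p) =
        signof p * (\<Prod>i = 0..<n. layer_at (\<beta> (p i) - \<alpha> i) (b i (p i)))"
      using layer_at_mult[of 0 "Elt (of_int (sign p)) 0" ?W "?t p"] prod[OF p] by simp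
  qed
  finally show "layer_at ?W (edet n b) = fdet n (\<lambda>i j. layer_at (\<beta> j - \<alpha> i) (b i j))" .
qed

text \<open>
  For tight potentials the common bound is the value of the determinant. Hence it
  is nonsingular exactly if the determinant of the layers that attain their bound is not 0.
\<close>

lemma edet_tight_potentials:
  fixes b :: "nat \<Rightarrow> nat \<Rightarrow> 'f::comm_ring_1 elt"
  assumes "edet n b \<noteq> 0"
  obtains \<alpha> \<beta> where
    "\<And>i j. i < n \<Longrightarrow> j < n \<Longrightarrow> bounded_by (\<beta> j - \<alpha> i) (b i j)"
    "\<And>j. j < n \<Longrightarrow> \<exists>i<n. has_value (\<beta> j - \<alpha> i) (b i j)"
    "has_value ((\<Sum>j<n. \<beta> j) - (\<Sum>i<n. \<alpha> i)) (edet n b)"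
proof -
  have "\<exists>r\<in>{p. p permutes {0..<n}}. Elt (of_int (sign r)) 0 * (\<Prod>i = 0..<n. b i (r i)) \<noteq> 0"
  proof (rule ccontr)
    assume "\<not> ?thesis"
    then have "edet n b = 0" unfolding edet_expand by (intro sum.neutral) simp
    then show False using assms by simp
  qed
  then obtain r where r: "r permutes {0..<n}"
    and nz: "Elt (of_int (sign r)) 0 * (\<Prod>i = 0..<n. b i (r i)) \<noteq> 0" by blast
  have fin: "b i (r i) \<noteq> NegInf" if "i < n" for i
  proof
    assume "b i (r i) = NegInf"
    then have "(\<Prod>i = 0..<n. b i (r i)) = 0"
      using that by (intro prod_zero) (auto simp: zero_elt_def)
    then show False using nz by simp
  qed
  from tight_potentials[where b = b, OF r fin] obtain \<alpha> \<beta> p where p: "p permutes {0..<n}"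
    and bnd: "\<forall>i<n. \<forall>j<n. bounded_by (\<beta> j - \<alpha> i) (b i j)"
    and tight: "\<forall>i<n. has_value (\<beta> (p i) - \<alpha> i) (b i (p i))" by blast
  let ?W = "(\<Sum>j<n. \<beta> j) - (\<Sum>i<n. \<alpha> i)"
  let ?t = "\<lambda>q. Elt (of_int (sign q)) 0 * (\<Prod>i = 0..<n. b i (q i))"
  show thesis
  proof
    show "bounded_by (\<beta> j - \<alpha> i) (b i j)" if "i < n" "j < n" for i j
      using bnd that by blast
    show "\<exists>i<n. has_value (\<beta> j - \<alpha> i) (b i j)" if "j < n" for j
    proof (intro exI conjI)
      let ?i = "inv_into UNIV p j"
      show "?i < n" using permutes_nat_less[OF permutes_inv[OF p] that] .
      then show "has_value (\<beta> j - \<alpha> ?i) (b ?i j)"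
        using tight[rule_format, of ?i] by (simp add: permutes_inverses(1)[OF p])
    qed
    have "has_value (\<Sum>i = 0..<n. \<beta> (p i) - \<alpha> i) (\<Prod>i = 0..<n. b i (p i))"
      using tight by (intro has_value_prod) simp_all
    then have "has_value (0 + ?W) (?t p)"
      unfolding sum_permuted_potentials[OF p] by (intro has_value_mult) simp
    moreover have "bounded_by (0 + ?W) (?t q)" if "q permutes {0..<n}" for q
    proof -
      have "bounded_by (\<Sum>i = 0..<n. \<beta> (q i) - \<alpha> i) (\<Prod>i = 0..<n. b i (q i))"
        using bnd permutes_nat_less[OF that] by (intro bounded_by_prod) simp_all
      then show ?thesis
        unfolding sum_permuted_potentials[OF that] by (intro bounded_by_mult) simp
    qed
    ultimately have "has_value (0 + ?W) (edet n b)"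
      unfolding edet_expand using p finite_permutations[of "{0..<n}"]
      by (intro has_value_sum[where k = p]) simp_all
    then show "has_value ?W (edet n b)" by simp
  qed
qed

text \<open>
  Measured against tight potentials, the layers of the coefficients of largest value in a
  dependence of the rows form a left kernel vector of the matrix of those layers that attain their
  bound. This matrix would be invertible if the determinant were nonsingular.
\<close>

lemma dependent_rows_singular:
  fixes b :: "nat \<Rightarrow> nat \<Rightarrow> 'f::field elt"
  assumes x: "\<And>i. i < n \<Longrightarrow> x i = 0 \<or> layer (x i) \<noteq> 0" and i0: "i0 < n" "x i0 \<noteq> 0"
    and dep: "\<And>j. j < n \<Longrightarrow> layer (\<Sum>i<n. x i * b i j) = 0"
  shows "layer (edet n b) = 0"
proof (rule ccontr)
  assume ns: "layer (edet n b) \<noteq> 0"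
  then have "edet n b \<noteq> 0" by auto
  then obtain \<alpha> \<beta> where
    bnd: "\<And>i j. i < n \<Longrightarrow> j < n \<Longrightarrow> bounded_by (\<beta> j - \<alpha> i) (b i j)" and
    W: "has_value ((\<Sum>j<n. \<beta> j) - (\<Sum>i<n. \<alpha> i)) (edet n b)"
    by (rule edet_tight_potentials) (rule that, auto)
  let ?X = "(\<lambda>i. tangible_value (x i) - \<alpha> i) ` {i. i < n \<and> x i \<noteq> 0}"
  define M where "M = Max ?X"
  have "finite ?X" "?X \<noteq> {}" using i0 by auto
  then have "M \<in> ?X" and le: "\<And>i. i < n \<Longrightarrow> x i \<noteq> 0 \<Longrightarrow> tangible_value (x i) - \<alpha> i \<le> M"
    unfolding M_def by (auto intro: Max_in Max_ge)
  then obtain i1 where i1: "i1 < n" "x i1 \<noteq> 0" "M = tangible_value (x i1) - \<alpha> i1" by auto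
  have xb: "bounded_by (M + \<alpha> i) (x i)" if "i < n" for i
    using le[OF that] by (cases "x i") (auto simp: zero_elt_def)
  define z where "z = (\<lambda>i. layer_at (M + \<alpha> i) (x i))"
  have "fdet n (\<lambda>i j. layer_at (\<beta> j - \<alpha> i) (b i j)) = 0"
  proof (rule fdet_left_kernel[where z = z])
    fix j assume j: "j < n"
    have summand: "bounded_by (M + \<beta> j) (x i * b i j)"
      "layer_at (M + \<beta> j) (x i * b i j) = z i * layer_at (\<beta> j - \<alpha> i) (b i j)" if "i < n" for i
      using bounded_by_mult[OF xb[OF that] bnd[OF that j]]
        layer_at_mult[OF xb[OF that] bnd[OF that j]] by (simp_all add: z_def)
    have "0 = layer_at (M + \<beta> j) (\<Sum>i<n. x i * b i j)"
      using dep[OF j] by (simp add: layer_zero_layer_at)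
    also have "\<dots> = (\<Sum>i<n. z i * layer_at (\<beta> j - \<alpha> i) (b i j))"
      by (subst layer_at_sum) (auto simp: summand)
    finally show "(\<Sum>i<n. z i * layer_at (\<beta> j - \<alpha> i) (b i j)) = 0" by simp
  next
    show "i1 < n" by (rule i1)
    show "z i1 \<noteq> 0" using i1 x[of i1] by (cases "x i1") (auto simp: z_def)
  qed
  then have "layer_at ((\<Sum>j<n. \<beta> j) - (\<Sum>i<n. \<alpha> i)) (edet n b) = 0"
    using layer_at_edet[OF bnd] by simp
  then show False using layer_at_has_value[OF W] ns by simp
qed

lemma equal_rows_singular:
  fixes b :: "nat \<Rightarrow> nat \<Rightarrow> 'f::field elt"
  assumes "i1 < n" "i2 < n" "i1 \<noteq> i2" "\<And>j. j < n \<Longrightarrow> b i1 j = b i2 j"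
  shows "layer (edet n b) = 0"
proof (rule dependent_rows_singular)
  let ?x = "\<lambda>i. if i = i1 then 1 else if i = i2 then Elt (-1) 0 else 0 :: 'f elt"
  show "?x i = 0 \<or> layer (?x i) \<noteq> 0" for i by auto
  show "i1 < n" "?x i1 \<noteq> 0" using assms(1) by auto
  fix j assume j: "j < n"
  have "(\<Sum>i<n. ?x i * b i j) = (\<Sum>i\<in>{i1, i2}. ?x i * b i j)"
    using assms(1,2) by (intro sum.mono_neutral_right) auto
  also have "\<dots> = b i2 j + Elt (-1) 0 * b i2 j"
    using assms(3) assms(4)[OF j] by simp
  finally show "layer (\<Sum>i<n. ?x i * b i j) = 0"
    by (cases "b i2 j") auto
qed

section \<open>Initial kernels\<close>

text \<open>
  The least \<open>c\<close> with \<open>\<alpha> i + y i \<le> c\<close> for all rows, that is, the best column potential for the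
  row potential \<open>\<alpha>\<close>. For a column without finite entries the maximum is taken over the empty set
  and has no meaning; such a column has no layers at any value.
\<close>

definition column_top :: "nat \<Rightarrow> (nat \<Rightarrow> 'f elt) \<Rightarrow> (nat \<Rightarrow> real) \<Rightarrow> real" where
  "column_top m y \<alpha> = Max ((\<lambda>i. \<alpha> i + tangible_value (y i)) ` {i. i < m \<and> y i \<noteq> NegInf})"

lemma bounded_by_column_top:
  assumes "i < m"
  shows "bounded_by (column_top m y \<alpha> - \<alpha> i) (y i)"
proof (cases "y i = NegInf")
  case False
  then have "\<alpha> i + tangible_value (y i) \<le> column_top m y \<alpha>"
    unfolding column_top_def using assms by (intro Max_ge) auto
  then show ?thesis by (cases "y i") auto
qed simp

lemma column_top_eqI:
  assumes "\<And>i. i < m \<Longrightarrow> bounded_by (c - \<alpha> i) (y i)"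
    and "i0 < m" "has_value (c - \<alpha> i0) (y i0)"
  shows "column_top m y \<alpha> = c"
  unfolding column_top_def
proof (rule Max_eqI)
  fix x assume "x \<in> (\<lambda>i. \<alpha> i + tangible_value (y i)) ` {i. i < m \<and> y i \<noteq> NegInf}"
  then obtain i where "i < m" "y i \<noteq> NegInf" "x = \<alpha> i + tangible_value (y i)" by auto
  then show "x \<le> c" using assms(1)[of i] by (cases "y i") auto
next
  have "y i0 \<noteq> NegInf" "c = \<alpha> i0 + tangible_value (y i0)"
    using assms(3) by (cases "y i0"; simp)+
  then show "c \<in> (\<lambda>i. \<alpha> i + tangible_value (y i)) ` {i. i < m \<and> y i \<noteq> NegInf}"
    using assms(2) by blast
qed simp

definition initial_layer ::
    "nat \<Rightarrow> (nat \<Rightarrow> 'c \<Rightarrow> 'f::zero elt) \<Rightarrow> (nat \<Rightarrow> real) \<Rightarrow> nat \<Rightarrow> 'c \<Rightarrow> 'f" where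
  "initial_layer m b \<alpha> i j = layer_at (column_top m (\<lambda>i. b i j) \<alpha> - \<alpha> i) (b i j)"

text \<open>
  The layers that a dependence of the rows could have if its values were exactly \<open>\<alpha>\<close>; vanishing
  coordinates are permitted, so an element need not be a dependence.
\<close>

definition initial_kernel ::
    "nat \<Rightarrow> 'c set \<Rightarrow> (nat \<Rightarrow> 'c \<Rightarrow> 'f::comm_ring_1 elt) \<Rightarrow> (nat \<Rightarrow> real) \<Rightarrow> (nat \<Rightarrow> 'f) set" where
  "initial_kernel m C b \<alpha> = {z. \<forall>j\<in>C. (\<Sum>i<m. z i * initial_layer m b \<alpha> i j) = 0}"

lemma initial_kernel_shift:
  "initial_kernel m C b (\<lambda>i. \<alpha> i + c) = initial_kernel m C b \<alpha>"
proof -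
  have "initial_layer m b (\<lambda>i. \<alpha> i + c) i j = initial_layer m b \<alpha> i j" if i: "i < m" for i j
  proof (cases "b i j = NegInf")
    case False
    let ?y = "\<lambda>i. b i j"
    let ?X = "(\<lambda>i. \<alpha> i + tangible_value (?y i)) ` {i. i < m \<and> ?y i \<noteq> NegInf}"
    have "(\<lambda>i. \<alpha> i + c + tangible_value (?y i)) ` {i. i < m \<and> ?y i \<noteq> NegInf} = (\<lambda>x. x + c) ` ?X"
      unfolding image_image by (intro image_cong) auto
    moreover have "Max ((\<lambda>x. x + c) ` ?X) = Max ?X + c"
    proof -
      have "finite ?X" "?X \<noteq> {}" using i False by auto
      then show ?thesis by (intro mono_Max_commute[symmetric]) (auto simp: mono_def)
    qed
    ultimately have "column_top m ?y (\<lambda>i. \<alpha> i + c) = column_top m ?y \<alpha> + c"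
      unfolding column_top_def by simp
    then show ?thesis unfolding initial_layer_def by simp
  qed (simp add: initial_layer_def)
  then show ?thesis unfolding initial_kernel_def by simp
qed

text \<open>
  Raising the potential of some rows either leaves the top of a column unchanged, and then
  the raised rows did not contribute to it before, or it removes all rows that were not raised from
  the top. In both cases the part of a kernel vector on these rows survives.
\<close>

lemma initial_kernel_restrict:
  assumes z: "z \<in> initial_kernel m C b \<gamma>" and le: "\<And>i. i < m \<Longrightarrow> \<gamma> i \<le> \<alpha> i"
  shows "(\<lambda>i. if \<gamma> i = \<alpha> i then z i else 0) \<in> initial_kernel m C b \<alpha>"
  unfolding initial_kernel_def
proof (intro CollectI ballI)
  fix j assume j: "j \<in> C"
  let ?y = "\<lambda>i. b i j"
  let ?t = "column_top m ?y \<alpha>"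
  show "(\<Sum>i<m. (if \<gamma> i = \<alpha> i then z i else 0) * initial_layer m b \<alpha> i j) = 0"
  proof (cases "\<exists>i<m. \<gamma> i = \<alpha> i \<and> has_value (?t - \<alpha> i) (?y i)")
    case True
    then obtain i0 where i0: "i0 < m" "\<gamma> i0 = \<alpha> i0" "has_value (?t - \<alpha> i0) (?y i0)" by blast
    have bnd: "bounded_by (?t - \<alpha> i) (?y i)" if "i < m" for i
      by (rule bounded_by_column_top[OF that])
    have "bounded_by (?t - \<gamma> i) (?y i)" if "i < m" for i
      using bnd[OF that] le[OF that] by (cases "?y i") auto
    then have top: "column_top m ?y \<gamma> = ?t"
      using i0 by (intro column_top_eqI[where ?i0.0 = i0]) auto
    have "(\<Sum>i<m. (if \<gamma> i = \<alpha> i then z i else 0) * initial_layer m b \<alpha> i j) =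
        (\<Sum>i<m. z i * initial_layer m b \<gamma> i j)"
    proof (intro sum.cong refl)
      fix i assume "i \<in> {..<m}"
      then have i: "i < m" by simp
      have "initial_layer m b \<gamma> i j = 0" if "\<gamma> i \<noteq> \<alpha> i"
        using bnd[OF i] le[OF i] that unfolding initial_layer_def top by (cases "?y i") auto
      then show "(if \<gamma> i = \<alpha> i then z i else 0) * initial_layer m b \<alpha> i j =
          z i * initial_layer m b \<gamma> i j"
        by (auto simp: initial_layer_def top)
    qed
    then show ?thesis using z j by (simp add: initial_kernel_def)
  next
    case False
    then have "initial_layer m b \<alpha> i j = 0" if "i < m" "\<gamma> i = \<alpha> i" for i
      using that unfolding initial_layer_def by (intro layer_at_not_has_value) auto
    then show ?thesis by (intro sum.neutral) auto
  qed
qed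

lemma nonsingular_minor_if_initial_kernel_trivial:
  fixes b :: "nat \<Rightarrow> 'c \<Rightarrow> 'f::field elt"
  assumes "\<And>z. z \<in> initial_kernel m C b \<alpha> \<Longrightarrow> \<forall>i<m. z i = 0"
  shows "\<exists>g. (\<forall>i<m. g i \<in> C) \<and> layer (edet m (\<lambda>i j. b i (g j))) \<noteq> 0"
proof (rule ccontr)
  assume sing: "\<not> ?thesis"
  have "\<exists>z. (\<exists>i<m. z i \<noteq> 0) \<and> (\<forall>j\<in>C. (\<Sum>i<m. z i * initial_layer m b \<alpha> i j) = 0)"
  proof (rule left_kernel_if_minors_vanish)
    fix g assume g: "\<forall>i<m. g i \<in> C"
    let ?\<beta> = "\<lambda>j. column_top m (\<lambda>i. b i (g j)) \<alpha>"
    have bnd: "bounded_by (?\<beta> j - \<alpha> i) (b i (g j))" if "i < m" "j < m" for i j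
      by (rule bounded_by_column_top[OF that(1)])
    have "fdet m (\<lambda>i j. layer_at (?\<beta> j - \<alpha> i) (b i (g j))) =
        layer_at ((\<Sum>j<m. ?\<beta> j) - (\<Sum>i<m. \<alpha> i)) (edet m (\<lambda>i j. b i (g j)))"
      by (rule layer_at_edet[symmetric]) (rule bnd)
    also have "\<dots> = 0"
      using sing g by (intro layer_zero_layer_at) blast
    finally show "fdet m (\<lambda>i j. initial_layer m b \<alpha> i (g j)) = 0"
      unfolding initial_layer_def .
  qed
  then obtain z where "\<exists>i<m. z i \<noteq> 0" "z \<in> initial_kernel m C b \<alpha>"
    unfolding initial_kernel_def by blast
  then show False using assms by blast
qed

text \<open>
  A kernel vector at the minimum of two potentials restricts to a kernel vector at each of them, and
  the rows \<open>k\<close> and \<open>l\<close> belong to both restrictions. Two independent linear conditions then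
  annihilate these two coordinates, hence both restrictions, hence the vector.
\<close>

lemma initial_kernel_min_trivial:
  fixes b :: "nat \<Rightarrow> 'c \<Rightarrow> 'f::field elt"
  assumes k: "k < m" "l < m" and eq: "\<alpha> k = \<alpha>' k" "\<alpha> l = \<alpha>' l"
    and ker: "\<And>z. z \<in> initial_kernel m C b \<alpha> \<Longrightarrow>
      z k * p + z l * q = 0 \<and> (z k = 0 \<and> z l = 0 \<longrightarrow> (\<forall>i<m. z i = 0))"
    and ker': "\<And>z. z \<in> initial_kernel m C b \<alpha>' \<Longrightarrow>
      z k * p' + z l * q' = 0 \<and> (z k = 0 \<and> z l = 0 \<longrightarrow> (\<forall>i<m. z i = 0))"
    and indep: "p * q' \<noteq> p' * q"
    and z: "z \<in> initial_kernel m C b (\<lambda>i. min (\<alpha> i) (\<alpha>' i))"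
  shows "\<forall>i<m. z i = 0"
proof -
  let ?\<gamma> = "\<lambda>i. min (\<alpha> i) (\<alpha>' i)"
  let ?r = "\<lambda>i. if ?\<gamma> i = \<alpha> i then z i else 0" and ?r' = "\<lambda>i. if ?\<gamma> i = \<alpha>' i then z i else 0"
  have r: "?r \<in> initial_kernel m C b \<alpha>" and r': "?r' \<in> initial_kernel m C b \<alpha>'"
    by (rule initial_kernel_restrict[OF z]; simp)+
  have rkl: "?r k = z k" "?r l = z l" "?r' k = z k" "?r' l = z l" using eq by auto
  have e: "z k * p + z l * q = 0" "z k * p' + z l * q' = 0"
    using ker[OF r] ker'[OF r'] rkl by auto
  have "z k * (p * q' - p' * q) = (z k * p + z l * q) * q' - (z k * p' + z l * q') * q"
    "z l * (p * q' - p' * q) = (z k * p' + z l * q') * p - (z k * p + z l * q) * p'"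
    by (simp_all add: algebra_simps)
  then have "z k * (p * q' - p' * q) = 0" "z l * (p * q' - p' * q) = 0"
    unfolding e by simp_all
  then have "z k = 0" "z l = 0" using indep by simp_all
  then have "\<forall>i<m. ?r i = 0" "\<forall>i<m. ?r' i = 0"
    using ker[OF r] ker'[OF r'] rkl by simp_all
  then show ?thesis by (metis min_def)
qed

section \<open>Pairs of minors that share all rows but the last\<close>

lemma bounded_by_add_iff:
  "bounded_by c (x + y :: 'f::comm_ring_1 elt) \<longleftrightarrow> bounded_by c x \<and> bounded_by c y"
  by (cases x; cases y) auto

lemma has_value_addD:
  "has_value c (x + y :: 'f::comm_ring_1 elt) \<Longrightarrow> has_value c x \<or> has_value c y"
  by (cases x; cases y) (auto split: if_splits)

lemma has_value_unique: "has_value c x \<Longrightarrow> has_value d x \<Longrightarrow> c = d"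
  by (cases x) auto

lemma bounded_by_scale:
  "bounded_by c (Elt 1 d * x :: 'f::comm_ring_1 elt) \<longleftrightarrow> bounded_by (c - d) x"
  by (cases x) auto

lemma has_value_scale:
  "has_value c (Elt 1 d * x :: 'f::comm_ring_1 elt) \<longleftrightarrow> has_value (c - d) x"
  by (cases x) auto

text \<open>
  Two minors \<open>u\<close> and \<open>v\<close> that differ in the last row only are summands of the determinant in which
  this row is the sum of the two rows, one of them shifted by \<open>d\<close>. Tight potentials for that
  determinant give a potential on all rows; every vector of its initial kernel satisfies the linear
  relation between the last two coordinates that has the initial layers of \<open>u\<close> and \<open>v\<close> as
  coefficients, and it vanishes if these two coordinates do.
\<close>

lemma exists_potential_for_two_minors:
  fixes b :: "nat \<Rightarrow> 'c \<Rightarrow> 'f::field elt" and g :: "nat \<Rightarrow> 'c"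
  assumes g: "\<forall>i<Suc k. g i \<in> C"
    and u: "u = edet (Suc k) (\<lambda>i j. if i < k then b i (g j) else b k (g j))"
    and v: "v = edet (Suc k) (\<lambda>i j. if i < k then b i (g j) else b (Suc k) (g j))"
    and W: "has_value W (Elt 1 d * u + v)"
    and nz: "layer_at (W - d) u \<noteq> 0 \<or> layer_at W v \<noteq> 0"
  shows "\<exists>\<alpha>. \<alpha> k = \<alpha> (Suc k) + d \<and> (\<forall>z\<in>initial_kernel (Suc (Suc k)) C b \<alpha>.
    z k * layer_at (W - d) u + z (Suc k) * layer_at W v = 0 \<and>
    (z k = 0 \<and> z (Suc k) = 0 \<longrightarrow> (\<forall>i<Suc (Suc k). z i = 0)))"
proof -
  let ?B = "\<lambda>i j. if i < k then b i (g j) else Elt 1 d * b k (g j) + 1 * b (Suc k) (g j)"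
  have B: "edet (Suc k) ?B = Elt 1 d * u + v"
    unfolding edet_linear_last_row u v by simp
  then have "edet (Suc k) ?B \<noteq> 0" using W by (auto simp: zero_elt_def)
  then obtain a \<beta> where
    bnd: "\<And>i j. i < Suc k \<Longrightarrow> j < Suc k \<Longrightarrow> bounded_by (\<beta> j - a i) (?B i j)" and
    hit: "\<And>j. j < Suc k \<Longrightarrow> \<exists>i<Suc k. has_value (\<beta> j - a i) (?B i j)" and
    val: "has_value ((\<Sum>j<Suc k. \<beta> j) - (\<Sum>i<Suc k. a i)) (edet (Suc k) ?B)"
    by (rule edet_tight_potentials) blast
  have W_eq: "W = (\<Sum>j<Suc k. \<beta> j) - (\<Sum>i<Suc k. a i)"
    using has_value_unique[OF W] val unfolding B by blast
  define \<alpha> where "\<alpha> = (\<lambda>i. if i < k then a i else if i = k then a k + d else a k)"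
  have \<alpha>: "\<alpha> i = a i" if "i < k" for i using that by (simp add: \<alpha>_def)
  have \<alpha>k: "\<alpha> k = a k + d" "\<alpha> (Suc k) = a k" by (simp_all add: \<alpha>_def)
  let ?L = "initial_layer (Suc (Suc k)) b \<alpha>"
  have bnd': "bounded_by (\<beta> j - \<alpha> i) (b i (g j))" if "i < Suc (Suc k)" "j < Suc k" for i j
  proof (cases "i < k")
    case True
    then show ?thesis using bnd[of i j] that by (simp add: \<alpha>_def)
  next
    case False
    then have "i = k \<or> i = Suc k" using that by linarith
    then show ?thesis
      using bnd[of k j] that by (auto simp: \<alpha>_def bounded_by_add_iff bounded_by_scale algebra_simps)
  qed
  have top: "column_top (Suc (Suc k)) (\<lambda>i. b i (g j)) \<alpha> = \<beta> j" if j: "j < Suc k" for j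
  proof -
    obtain i where i: "i < Suc k" "has_value (\<beta> j - a i) (?B i j)" using hit[OF j] by blast
    have "\<exists>i'<Suc (Suc k). has_value (\<beta> j - \<alpha> i') (b i' (g j))"
    proof (cases "i < k")
      case True
      then show ?thesis using i by (intro exI[of _ i]) (simp add: \<alpha>_def)
    next
      case False
      then have "i = k" using i(1) by simp
      then have "has_value (\<beta> j - a k) (Elt 1 d * b k (g j)) \<or> has_value (\<beta> j - a k) (b (Suc k) (g j))"
        using has_value_addD i(2) by fastforce
      then show ?thesis
      proof
        assume "has_value (\<beta> j - a k) (Elt 1 d * b k (g j))"
        then show ?thesis
          by (intro exI[of _ k]) (simp add: \<alpha>_def has_value_scale algebra_simps)
      next
        assume "has_value (\<beta> j - a k) (b (Suc k) (g j))"
        then show ?thesis by (intro exI[of _ "Suc k"]) (simp add: \<alpha>_def)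
      qed
    qed
    then obtain i' where "i' < Suc (Suc k)" "has_value (\<beta> j - \<alpha> i') (b i' (g j))" by blast
    then show ?thesis using bnd' j by (intro column_top_eqI[where ?i0.0 = i']) auto
  qed
  have p: "layer_at (W - d) u = fdet (Suc k) (\<lambda>i j. if i < k then ?L i (g j) else ?L k (g j))"
  proof -
    have "(\<Sum>j<Suc k. \<beta> j) - (\<Sum>i<Suc k. \<alpha> i) = W - d"
      unfolding W_eq by (simp add: \<alpha>_def)
    moreover have "layer_at ((\<Sum>j<Suc k. \<beta> j) - (\<Sum>i<Suc k. \<alpha> i)) u =
        fdet (Suc k) (\<lambda>i j. layer_at (\<beta> j - \<alpha> i) (if i < k then b i (g j) else b k (g j)))"
      unfolding u
    proof (rule layer_at_edet)
      fix i j assume ij: "i < Suc k" "j < Suc k"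
      then show "bounded_by (\<beta> j - \<alpha> i) (if i < k then b i (g j) else b k (g j))"
        using bnd'[of i j] by (auto simp: less_Suc_eq)
    qed
    moreover have "fdet (Suc k) (\<lambda>i j. layer_at (\<beta> j - \<alpha> i) (if i < k then b i (g j) else b k (g j))) =
        fdet (Suc k) (\<lambda>i j. if i < k then ?L i (g j) else ?L k (g j))"
      by (rule fdet_cong) (auto simp: initial_layer_def top less_Suc_eq)
    ultimately show ?thesis by simp
  qed
  have q: "layer_at W v = fdet (Suc k) (\<lambda>i j. if i < k then ?L i (g j) else ?L (Suc k) (g j))"
  proof -
    have "layer_at ((\<Sum>j<Suc k. \<beta> j) - (\<Sum>i<Suc k. a i)) v =
        fdet (Suc k) (\<lambda>i j. layer_at (\<beta> j - a i) (if i < k then b i (g j) else b (Suc k) (g j)))"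
      unfolding v
    proof (rule layer_at_edet)
      fix i j assume ij: "i < Suc k" "j < Suc k"
      then show "bounded_by (\<beta> j - a i) (if i < k then b i (g j) else b (Suc k) (g j))"
        using bnd'[of i j] bnd'[of "Suc k" j] by (auto simp: less_Suc_eq \<alpha>_def)
    qed
    moreover have "fdet (Suc k) (\<lambda>i j. layer_at (\<beta> j - a i) (if i < k then b i (g j) else b (Suc k) (g j))) =
        fdet (Suc k) (\<lambda>i j. if i < k then ?L i (g j) else ?L (Suc k) (g j))"
      by (rule fdet_cong) (auto simp: initial_layer_def top less_Suc_eq \<alpha> \<alpha>k)
    ultimately show ?thesis unfolding W_eq by simp
  qed
  have "z k * layer_at (W - d) u + z (Suc k) * layer_at W v = 0 \<and>
      (z k = 0 \<and> z (Suc k) = 0 \<longrightarrow> (\<forall>i<Suc (Suc k). z i = 0))"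
    if "z \<in> initial_kernel (Suc (Suc k)) C b \<alpha>" for z
  proof
    have ker: "(\<Sum>i<k. z i * ?L i (g j)) + z k * ?L k (g j) + z (Suc k) * ?L (Suc k) (g j) = 0"
      if j: "j < Suc k" for j
      using that g \<open>z \<in> _\<close> unfolding initial_kernel_def by auto
    \<comment> \<open>Collapsing the last two rows with the weights from the kernel vector gives a square matrix with a left kernel vector.\<close>
    have "fdet (Suc k) (\<lambda>i j. if i < k then ?L i (g j) else
        z k * ?L k (g j) + z (Suc k) * ?L (Suc k) (g j)) = 0"
    proof (rule fdet_left_kernel[where z = "\<lambda>i. if i < k then z i else 1" and ?i0.0 = k])
      fix j assume "j < Suc k"
      from ker[OF this] show "(\<Sum>i<Suc k. (if i < k then z i else 1) *
          (if i < k then ?L i (g j) else z k * ?L k (g j) + z (Suc k) * ?L (Suc k) (g j))) = 0"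
        by (simp add: algebra_simps)
    qed auto
    then show "z k * layer_at (W - d) u + z (Suc k) * layer_at W v = 0"
      unfolding fdet_linear_last_row p q .
    show "z k = 0 \<and> z (Suc k) = 0 \<longrightarrow> (\<forall>i<Suc (Suc k). z i = 0)"
    proof (intro impI, rule ccontr)
      assume z0: "z k = 0 \<and> z (Suc k) = 0" and "\<not> (\<forall>i<Suc (Suc k). z i = 0)"
      then obtain i0 where i0: "i0 < k" "z i0 \<noteq> 0" by (auto simp: less_Suc_eq)
      \<comment> \<open>The remaining coordinates annihilate the first rows alone, so the choice of the last row does not matter.\<close>
      have "fdet (Suc k) (\<lambda>i j. if i < k then ?L i (g j) else r j) = 0" for r
      proof (rule fdet_left_kernel[where z = "\<lambda>i. if i < k then z i else 0" and ?i0.0 = i0])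
        fix j assume "j < Suc k"
        from ker[OF this] show "(\<Sum>i<Suc k. (if i < k then z i else 0) *
            (if i < k then ?L i (g j) else r j)) = 0"
          using z0 by simp
      qed (use i0 in auto)
      then show False using nz unfolding p q by simp
    qed
  qed
  then have "\<forall>z\<in>initial_kernel (Suc (Suc k)) C b \<alpha>.
      z k * layer_at (W - d) u + z (Suc k) * layer_at W v = 0 \<and>
      (z k = 0 \<and> z (Suc k) = 0 \<longrightarrow> (\<forall>i<Suc (Suc k). z i = 0))" by (rule ballI)
  moreover have "\<alpha> k = \<alpha> (Suc k) + d" by (simp add: \<alpha>k)
  ultimately show ?thesis by (intro exI[of _ \<alpha>] conjI)
qed

text \<open>
  The shift \<open>d\<close> must let \<open>u\<close> dominate \<open>v\<close> while \<open>v'\<close> dominates \<open>u'\<close>; that such a \<open>d\<close> exists is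
  the statement that \<open>u * v'\<close> has larger value than \<open>u' * v\<close>.
\<close>

lemma separating_value_if_dominant:
  fixes u v u' v' :: "'f::comm_ring_1 elt"
  assumes "\<exists>l a m' b'. u = Elt l a \<and> v' = Elt m' b' \<and> l * m' \<noteq> 0 \<and>
    (\<forall>l' a' m b. u' = Elt l' a' \<longrightarrow> v = Elt m b \<longrightarrow> a' + b < a + b')"
  shows "\<exists>d W W'. has_value W (Elt 1 d * u + v) \<and> has_value W' (Elt 1 d * u' + v') \<and>
    layer_at (W - d) u * layer_at W' v' \<noteq> 0 \<and> layer_at (W' - d) u' * layer_at W v = 0"
proof -
  obtain l a m' b' where uv: "u = Elt l a" "v' = Elt m' b'" and nz: "l * m' \<noteq> 0"
    and dom: "\<forall>l' a' m b. u' = Elt l' a' \<longrightarrow> v = Elt m b \<longrightarrow> a' + b < a + b'"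
    using assms by (elim exE conjE)
  have "\<exists>d. (\<forall>m b. v = Elt m b \<longrightarrow> b < d + a) \<and> (\<forall>l' a'. u' = Elt l' a' \<longrightarrow> d + a' < b')"
  proof (cases u'; cases v)
    fix l' a' m b assume uv': "u' = Elt l' a'" "v = Elt m b"
    then have "b - a < b' - a'" using dom by fastforce
    then obtain d where "b - a < d" "d < b' - a'" using dense by blast
    then show ?thesis using uv' by (intro exI[of _ d]) auto
  next
    fix l' a' assume "u' = Elt l' a'" "v = NegInf"
    then show ?thesis by (intro exI[of _ "b' - a' - 1"]) auto
  next
    fix m b assume "u' = NegInf" "v = Elt m b"
    then show ?thesis by (intro exI[of _ "b - a + 1"]) auto
  qed auto
  then obtain d where d: "\<forall>m b. v = Elt m b \<longrightarrow> b < d + a" "\<forall>l' a'. u' = Elt l' a' \<longrightarrow> d + a' < b'"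
    by blast
  have "has_value (d + a) (Elt 1 d * u + v)"
    using d(1) uv(1) by (cases v) auto
  moreover have "has_value b' (Elt 1 d * u' + v')" "layer_at (b' - d) u' = 0"
    using d(2) uv(2) by (cases u'; auto)+
  moreover have "layer_at (d + a - d) u * layer_at b' v' \<noteq> 0"
    using uv nz by simp
  ultimately show ?thesis
    by (intro exI[of _ d] exI[of _ "d + a"] exI[of _ b']) simp
qed

text \<open>
  If the values of \<open>u * v'\<close> and \<open>u' * v\<close> agree, the shift that balances both pairs
  at once is the right one; otherwise one of the products dominates.
\<close>

lemma separating_value:
  fixes u v u' v' :: "'f::comm_ring_1 elt"
  assumes nz: "layer (u * v' + Elt (- 1) 0 * (u' * v)) \<noteq> 0"
  shows "\<exists>d W W'. has_value W (Elt 1 d * u + v) \<and> has_value W' (Elt 1 d * u' + v') \<and>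
    layer_at (W - d) u * layer_at W' v' \<noteq> layer_at (W' - d) u' * layer_at W v"
proof -
  let ?dominant = "\<lambda>u v u' v'. \<exists>l a m' b'. u = Elt l a \<and> v' = Elt m' b' \<and> l * m' \<noteq> 0 \<and>
    (\<forall>l' a' m b. u' = Elt l' a' \<longrightarrow> v = Elt m b \<longrightarrow> a' + b < a + b')"
  consider (left) "?dominant u v u' v'" | (right) "?dominant u' v' u v"
    | (tie) "\<not> ?dominant u v u' v'" "\<not> ?dominant u' v' u v" by blast
  then show ?thesis
  proof cases
    case left
    from separating_value_if_dominant[OF left] obtain d W W' where
      "has_value W (Elt 1 d * u + v)" "has_value W' (Elt 1 d * u' + v')"
      "layer_at (W - d) u * layer_at W' v' \<noteq> 0" "layer_at (W' - d) u' * layer_at W v = 0"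
      by (elim exE conjE)
    then show ?thesis by (intro exI[of _ d] exI[of _ W] exI[of _ W']) simp
  next
    case right
    from separating_value_if_dominant[OF right] obtain d W W' where
      "has_value W (Elt 1 d * u' + v')" "has_value W' (Elt 1 d * u + v)"
      "layer_at (W - d) u' * layer_at W' v \<noteq> 0" "layer_at (W' - d) u * layer_at W v' = 0"
      by (elim exE conjE)
    then show ?thesis by (intro exI[of _ d] exI[of _ W'] exI[of _ W]) simp
  next
    case tie
    then obtain l a m b l' a' m' b' where uv: "u = Elt l a" "v = Elt m b" "u' = Elt l' a'" "v' = Elt m' b'"
      and "a' + b = a + b'"
      using nz by (cases u; cases v; cases u'; cases v') (auto split: if_splits)
    then have b': "b' = a' + b - a" by linarith
    show ?thesis
      using nz by (intro exI[of _ "b - a"] exI[of _ b] exI[of _ b']) (simp add: uv b')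
  qed
qed

text \<open>
  Over a field this is a consequence of the Pluecker relations, which do not carry over: products
  of layer 0 that cancel there may dominate here. Instead, if the claim failed, the initial layers of
  the two pairs would be linearly independent for a suitable shift \<open>d\<close>, and the minimum of the two
  potentials belonging to the pairs would have a trivial initial kernel, which
  produces a nonsingular minor of full order.
\<close>

lemma minor_pairs_proportional:
  fixes b :: "nat \<Rightarrow> 'c \<Rightarrow> 'f::field elt" and k :: nat
  defines "u \<equiv> \<lambda>g. edet (Suc k) (\<lambda>i j. if i < k then b i (g j) else b k (g j))"
    and "v \<equiv> \<lambda>g. edet (Suc k) (\<lambda>i j. if i < k then b i (g j) else b (Suc k) (g j))"
  assumes sing: "\<And>g. (\<forall>i<Suc (Suc k). g i \<in> C) \<Longrightarrow> layer (edet (Suc (Suc k)) (\<lambda>i j. b i (g j))) = 0"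
    and g: "\<forall>i<Suc k. g i \<in> C" and h: "\<forall>i<Suc k. h i \<in> C"
  shows "layer (u g * v h + Elt (- 1) 0 * (u h * v g)) = 0"
proof (rule ccontr)
  let ?m = "Suc (Suc k)"
  assume "layer (u g * v h + Elt (- 1) 0 * (u h * v g)) \<noteq> 0"
  from separating_value[OF this] obtain d W W' where
    W: "has_value W (Elt 1 d * u g + v g)" "has_value W' (Elt 1 d * u h + v h)" and
    indep: "layer_at (W - d) (u g) * layer_at W' (v h) \<noteq> layer_at (W' - d) (u h) * layer_at W (v g)"
    by (elim exE conjE)
  let ?p = "layer_at (W - d) (u g)" and ?q = "layer_at W (v g)"
  let ?p' = "layer_at (W' - d) (u h)" and ?q' = "layer_at W' (v h)"
  let ?ok = "\<lambda>\<alpha> p q. \<forall>z\<in>initial_kernel ?m C b \<alpha>. z k * p + z (Suc k) * q = 0 \<and>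
    (z k = 0 \<and> z (Suc k) = 0 \<longrightarrow> (\<forall>i<?m. z i = 0))"
  have "?p \<noteq> 0 \<or> ?q \<noteq> 0" "?p' \<noteq> 0 \<or> ?q' \<noteq> 0" using indep by auto
  then have "\<exists>\<alpha>. \<alpha> k = \<alpha> (Suc k) + d \<and> ?ok \<alpha> ?p ?q" "\<exists>\<alpha>. \<alpha> k = \<alpha> (Suc k) + d \<and> ?ok \<alpha> ?p' ?q'"
    using exists_potential_for_two_minors[OF g, of "u g" b "v g" W d]
      exists_potential_for_two_minors[OF h, of "u h" b "v h" W' d] W
    unfolding u_def v_def by simp_all
  then obtain \<alpha> \<alpha>' where a: "\<alpha> k = \<alpha> (Suc k) + d \<and> ?ok \<alpha> ?p ?q"
    and a': "\<alpha>' k = \<alpha>' (Suc k) + d \<and> ?ok \<alpha>' ?p' ?q'"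
    by (elim exE)
  note \<alpha> = conjunct1[OF a] conjunct2[OF a] and \<alpha>' = conjunct1[OF a'] conjunct2[OF a']
  \<comment> \<open>Both potentials have the same difference at the two distinguished rows, so a shift makes
    them agree there.\<close>
  define \<alpha>'' where "\<alpha>'' = (\<lambda>i. \<alpha>' i + (\<alpha> k - \<alpha>' k))"
  have eq: "\<alpha> k = \<alpha>'' k" "\<alpha> (Suc k) = \<alpha>'' (Suc k)"
    using \<alpha>(1) \<alpha>'(1) unfolding \<alpha>''_def by simp_all
  have \<alpha>'': "?ok \<alpha>'' ?p' ?q'"
    unfolding \<alpha>''_def initial_kernel_shift by (rule \<alpha>'(2))
  have "\<forall>i<?m. z i = 0" if z: "z \<in> initial_kernel ?m C b (\<lambda>i. min (\<alpha> i) (\<alpha>'' i))" for z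
  proof (rule initial_kernel_min_trivial[of k ?m "Suc k" \<alpha> \<alpha>'' C b ?p ?q ?p' ?q' z])
    fix z assume "z \<in> initial_kernel ?m C b \<alpha>"
    then show "z k * ?p + z (Suc k) * ?q = 0 \<and> (z k = 0 \<and> z (Suc k) = 0 \<longrightarrow> (\<forall>i<?m. z i = 0))"
      by (rule \<alpha>(2)[THEN bspec])
  next
    fix z assume "z \<in> initial_kernel ?m C b \<alpha>''"
    then show "z k * ?p' + z (Suc k) * ?q' = 0 \<and> (z k = 0 \<and> z (Suc k) = 0 \<longrightarrow> (\<forall>i<?m. z i = 0))"
      by (rule \<alpha>''[THEN bspec])
  qed (fact eq indep z | simp)+
  then have "\<exists>g. (\<forall>i<?m. g i \<in> C) \<and> layer (edet ?m (\<lambda>i j. b i (g j))) \<noteq> 0"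
    by (rule nonsingular_minor_if_initial_kernel_trivial)
  then show False using sing by blast
qed

section \<open>Dependence of the rows\<close>

text \<open>
  The theorem for two rows. A column with two entries of nonzero layer determines the coefficients up
  to scaling. If there is no such column and neither coefficient can be chosen to be 0, each column
  bounds the difference of the values of the coefficients on at most one side, and pairwise compatible
  bounds have a common solution.
\<close>

lemma two_row_dependence:
  fixes P :: "('f::field elt \<times> 'f elt) set"
  assumes fin: "finite P"
    and pair: "\<And>u v u' v'. (u, v) \<in> P \<Longrightarrow> (u', v') \<in> P \<Longrightarrow>
      layer (u * v' + Elt (- 1) 0 * (u' * v)) = 0"
  shows "\<exists>x y. (x = 0 \<or> layer x \<noteq> 0) \<and> (y = 0 \<or> layer y \<noteq> 0) \<and> (x \<noteq> 0 \<or> y \<noteq> 0) \<and>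
    (\<forall>(u, v)\<in>P. layer (x * u + y * v) = 0)"
proof -
  consider (fst) "\<forall>(u, v)\<in>P. layer u = 0" | (snd) "\<forall>(u, v)\<in>P. layer v = 0"
    | (both) u0 v0 where "(u0, v0) \<in> P" "layer u0 \<noteq> 0" "layer v0 \<noteq> 0"
    | (split) "\<exists>(u, v)\<in>P. layer u \<noteq> 0" "\<exists>(u, v)\<in>P. layer v \<noteq> 0"
        "\<forall>(u, v)\<in>P. layer u = 0 \<or> layer v = 0"
    by fast
  then show ?thesis
  proof cases
    case fst
    then show ?thesis by (intro exI[of _ 1] exI[of _ 0]) auto
  next
    case snd
    then show ?thesis by (intro exI[of _ 0] exI[of _ 1]) auto
  next
    case both
    have "layer (v0 * u + Elt (- 1) 0 * u0 * v) = 0" if "(u, v) \<in> P" for u v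
      using pair[OF that both(1)] by (simp add: ac_simps)
    then show ?thesis
      using both(2,3) by (intro exI[of _ v0] exI[of _ "Elt (- 1) 0 * u0"]) (auto simp: layer_mult)
  next
    case split
    let ?X = "{(u, v) \<in> P. layer u \<noteq> 0}" and ?Y = "{(u, v) \<in> P. layer v \<noteq> 0}"
    let ?s = "\<lambda>(u, v). tangible_value v - tangible_value u"
    have less: "?s y < ?s x \<and> snd x \<noteq> NegInf \<and> fst y \<noteq> NegInf" if xy: "x \<in> ?X" "y \<in> ?Y" for x y
    proof -
      obtain u v u' v' where e: "x = (u, v)" "y = (u', v')" by (cases x; cases y)
      then have "layer u \<noteq> 0" "layer v = 0" "layer u' = 0" "layer v' \<noteq> 0"
        using xy split(3) by auto
      moreover have "layer (u * v' + Elt (- 1) 0 * (u' * v)) = 0"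
        using xy pair by (auto simp: e)
      ultimately show ?thesis
        by (cases u; cases v; cases u'; cases v') (auto simp: e split: if_splits)
    qed
    have ne: "finite (?s ` ?X)" "?s ` ?X \<noteq> {}" "finite (?s ` ?Y)" "?s ` ?Y \<noteq> {}"
      using fin split(1,2) by (auto intro: finite_subset[OF _ fin])
    then have "Max (?s ` ?Y) \<in> ?s ` ?Y" "Min (?s ` ?X) \<in> ?s ` ?X" by (auto intro: Max_in Min_in)
    then obtain x0 y0 where "x0 \<in> ?X" "y0 \<in> ?Y" "Min (?s ` ?X) = ?s x0" "Max (?s ` ?Y) = ?s y0"
      by (elim imageE) blast
    then have "Max (?s ` ?Y) < Min (?s ` ?X)" using less[of x0 y0] by simp
    then obtain e where e: "Max (?s ` ?Y) < e" "e < Min (?s ` ?X)" using dense by blast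
    have X: "e < ?s x" "snd x \<noteq> NegInf" if "x \<in> ?X" for x
      using e(2) Min_le[OF ne(1) imageI[OF that]] less[OF that \<open>y0 \<in> ?Y\<close>] by auto
    have Y: "?s y < e" "fst y \<noteq> NegInf" if "y \<in> ?Y" for y
      using e(1) Max_ge[OF ne(3) imageI[OF that]] less[OF \<open>x0 \<in> ?X\<close> that] by auto
    have "layer (Elt 1 e * u + 1 * v) = 0" if uv: "(u, v) \<in> P" for u v
    proof -
      consider "layer u \<noteq> 0" | "layer v \<noteq> 0" | "layer u = 0" "layer v = 0" by blast
      then show ?thesis
      proof cases
        case 1
        then have "layer v = 0" using split(3) uv by auto
        then show ?thesis using X[of "(u, v)"] 1 uv by (cases u; cases v) auto
      next
        case 2
        then have "layer u = 0" using split(3) uv by auto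
        then show ?thesis using Y[of "(u, v)"] 2 uv by (cases u; cases v) auto
      next
        case 3
        then show ?thesis by (intro layer_sum_elt_zero) (simp_all add: layer_mult)
      qed
    qed
    then show ?thesis by (intro exI[of _ "Elt 1 e"] exI[of _ 1]) auto
  qed
qed

text \<open>
  Replacing the last two rows by one combination \<open>x * b k j + y * b (Suc k) j\<close> turns each
  minor of order \<open>m - 1\<close> into \<open>x * u + y * v\<close>. By proportionality of the pairs \<open>(u, v)\<close> there are \<open>x\<close> and \<open>y\<close>
  which make all of them singular, and a dependence of the smaller matrix, which the induction
  provides, expands to one of the original matrix.
\<close>

theorem dependent_rows_if_minors_singular:
  fixes b :: "nat \<Rightarrow> 'c \<Rightarrow> 'f::field elt"
  assumes "finite C"
    and "\<And>g. (\<forall>i<m. g i \<in> C) \<Longrightarrow> layer (edet m (\<lambda>i j. b i (g j))) = 0"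
  shows "\<exists>x. (\<forall>i<m. x i = 0 \<or> layer (x i) \<noteq> 0) \<and> (\<exists>i<m. x i \<noteq> 0) \<and>
    (\<forall>j\<in>C. layer (\<Sum>i<m. x i * b i j) = 0)"
  using assms(2)
proof (induction m arbitrary: b rule: induct_nat_012)
  case 0
  then show ?case by (simp add: edet_expand)
next
  case 1
  have "layer (b 0 j) = 0" if "j \<in> C" for j
    using 1[of "\<lambda>_. j"] that by (simp add: edet_expand layer_mult)
  then show ?case by (intro exI[of _ "\<lambda>_. 1"]) simp
next
  case (ge2 k)
  define u where "u = (\<lambda>g :: nat \<Rightarrow> 'c. edet (Suc k) (\<lambda>i j. if i < k then b i (g j) else b k (g j)))"
  define v where "v = (\<lambda>g :: nat \<Rightarrow> 'c. edet (Suc k) (\<lambda>i j. if i < k then b i (g j) else b (Suc k) (g j)))"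
  let ?G = "PiE {..<Suc k} (\<lambda>_. C)"
  have "\<exists>x y. (x = 0 \<or> layer x \<noteq> 0) \<and> (y = 0 \<or> layer y \<noteq> 0) \<and> (x \<noteq> 0 \<or> y \<noteq> 0) \<and>
      (\<forall>(s, t)\<in>(\<lambda>g. (u g, v g)) ` ?G. layer (x * s + y * t) = 0)"
  proof (rule two_row_dependence)
    show "finite ((\<lambda>g. (u g, v g)) ` ?G)"
      using assms(1) by (intro finite_imageI finite_PiE) auto
  next
    fix s t s' t' assume "(s, t) \<in> (\<lambda>g. (u g, v g)) ` ?G" "(s', t') \<in> (\<lambda>g. (u g, v g)) ` ?G"
    then obtain g h where "g \<in> ?G" "h \<in> ?G" "s = u g" "t = v g" "s' = u h" "t' = v h" by auto
    moreover from this have "layer (u g * v h + Elt (- 1) 0 * (u h * v g)) = 0"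
      unfolding u_def v_def by (intro minor_pairs_proportional[OF ge2.prems]) (auto simp: PiE_iff)
    ultimately show "layer (s * t' + Elt (- 1) 0 * (s' * t)) = 0" by simp
  qed
  then obtain x y where xy: "x = 0 \<or> layer x \<noteq> 0" "y = 0 \<or> layer y \<noteq> 0" "x \<noteq> 0 \<or> y \<noteq> 0"
    and dep: "\<forall>(s, t)\<in>(\<lambda>g. (u g, v g)) ` ?G. layer (x * s + y * t) = 0"
    by (elim exE conjE)
  let ?b = "\<lambda>i j. if i < k then b i j else x * b k j + y * b (Suc k) j"
  have "\<exists>z. (\<forall>i<Suc k. z i = 0 \<or> layer (z i) \<noteq> 0) \<and> (\<exists>i<Suc k. z i \<noteq> 0) \<and>
      (\<forall>j\<in>C. layer (\<Sum>i<Suc k. z i * ?b i j) = 0)"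
  proof (rule ge2.IH(2))
    fix g assume g: "\<forall>i<Suc k. g i \<in> C"
    let ?g = "restrict g {..<Suc k}"
    have "u g = u ?g" "v g = v ?g" unfolding u_def v_def by (auto intro!: edet_cong)
    moreover have "?g \<in> ?G" using g by auto
    then have "layer (x * u ?g + y * v ?g) = 0" using dep by fast
    ultimately show "layer (edet (Suc k) (\<lambda>i j. ?b i (g j))) = 0"
      unfolding edet_linear_last_row u_def v_def by simp
  qed
  then obtain z where "(\<forall>i<Suc k. z i = 0 \<or> layer (z i) \<noteq> 0) \<and> (\<exists>i<Suc k. z i \<noteq> 0) \<and>
      (\<forall>j\<in>C. layer (\<Sum>i<Suc k. z i * ?b i j) = 0)" ..
  then have z: "\<forall>i<Suc k. z i = 0 \<or> layer (z i) \<noteq> 0" "\<exists>i<Suc k. z i \<noteq> 0"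
    "\<forall>j\<in>C. layer (\<Sum>i<Suc k. z i * ?b i j) = 0"
    by simp_all
  have prod: "z k * w = 0 \<or> layer (z k * w) \<noteq> 0" "z k \<noteq> 0 \<Longrightarrow> w \<noteq> 0 \<Longrightarrow> z k * w \<noteq> 0"
    if "w = 0 \<or> layer w \<noteq> 0" for w
    using that z(1)[rule_format, of k] layer_mult[of "z k" w] by auto
  let ?z = "\<lambda>i. if i < k then z i else if i = k then z k * x else z k * y"
  have "\<forall>i<Suc (Suc k). ?z i = 0 \<or> layer (?z i) \<noteq> 0"
    using z(1) prod(1)[OF xy(1)] prod(1)[OF xy(2)] by auto
  moreover have "\<exists>i<Suc (Suc k). ?z i \<noteq> 0"
  proof -
    obtain i where i: "i < Suc k" "z i \<noteq> 0" using z(2) by blast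
    show ?thesis
    proof (cases "i < k")
      case True
      then show ?thesis using i by (intro exI[of _ i]) simp
    next
      case False
      then have "z k \<noteq> 0" using i by (simp add: less_Suc_eq)
      then have "?z k \<noteq> 0 \<or> ?z (Suc k) \<noteq> 0"
        using xy(3) prod(2)[OF xy(1)] prod(2)[OF xy(2)] by auto
      then show ?thesis by (meson lessI less_Suc_eq)
    qed
  qed
  moreover have "layer (\<Sum>i<Suc (Suc k). ?z i * b i j) = 0" if "j \<in> C" for j
  proof -
    have "(\<Sum>i<Suc (Suc k). ?z i * b i j) = (\<Sum>i<Suc k. z i * ?b i j)"
      by (simp add: algebra_simps)
    then show ?thesis using z(3) that by simp
  qed
  ultimately show ?case by (intro exI[of _ ?z]) simp
qed

section \<open>The three ranks\<close>

text \<open>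
  Rows and columns are selected by arbitrary functions instead of increasing ones: this frees the
  comparison of the three ranks from orderings, and a selection with repetitions cannot
  yield a nonsingular minor anyway.
\<close>

definition has_nonsingular_minor :: "'f::comm_ring_1 elt mat \<Rightarrow> nat \<Rightarrow> bool" where
  "has_nonsingular_minor A r \<longleftrightarrow> (\<exists>f g. (\<forall>i<r. f i < dim_row A) \<and> (\<forall>j<r. g j < dim_col A) \<and>
    layer (edet r (\<lambda>i j. A $$ (f i, g j))) \<noteq> 0)"

lemma edet_nonsingular_inj:
  fixes b :: "'a \<Rightarrow> 'c \<Rightarrow> 'f::field elt"
  assumes "layer (edet r (\<lambda>i j. b (f i) (g j))) \<noteq> 0"
  shows "inj_on f {..<r}" "inj_on g {..<r}"
proof -
  show "inj_on f {..<r}"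
  proof (rule inj_onI, rule ccontr)
    fix x y assume xy: "x \<in> {..<r}" "y \<in> {..<r}" "f x = f y" "x \<noteq> y"
    have "layer (edet r (\<lambda>i j. b (f i) (g j))) = 0"
      by (rule equal_rows_singular[of x r y]) (use xy in auto)
    then show False using assms by simp
  qed
  show "inj_on g {..<r}"
  proof (rule inj_onI, rule ccontr)
    fix x y assume xy: "x \<in> {..<r}" "y \<in> {..<r}" "g x = g y" "x \<noteq> y"
    have "layer (edet r (\<lambda>j i. b (f i) (g j))) = 0"
      by (rule equal_rows_singular[of x r y]) (use xy in auto)
    then show False using assms edet_transpose[of r "\<lambda>j i. b (f i) (g j)"] by simp
  qed
qed

lemma independent_iff_nonsingular_minor:
  fixes v :: "nat \<Rightarrow> 'f::field elt vec"
  assumes e: "bij_betw e {..<r} I" and v: "\<And>i. i \<in> I \<Longrightarrow> v i \<in> carrier_vec n"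
  shows "\<not> elt_lin_dep n v I \<longleftrightarrow>
    (\<exists>g. (\<forall>j<r. g j < n) \<and> layer (edet r (\<lambda>i j. v (e i) $ g j)) \<noteq> 0)"
proof -
  have eI: "e i \<in> I" if "i < r" for i using e that by (auto simp: bij_betw_def)
  have finI: "finite I" using e bij_betw_finite by blast
  have comb: "map_vec layer (finsum_vec TYPE('f elt) n (\<lambda>i. a i \<cdot>\<^sub>v v i) S) = 0\<^sub>v n \<longleftrightarrow>
      (\<forall>j<n. layer (\<Sum>i\<in>S. a i * v i $ j) = 0)" if S: "S \<subseteq> I" for a S
  proof -
    let ?w = "finsum_vec TYPE('f elt) n (\<lambda>i. a i \<cdot>\<^sub>v v i) S"
    have fin: "finite S" using S finI by (rule finite_subset)
    have car: "(\<lambda>i. a i \<cdot>\<^sub>v v i) \<in> S \<rightarrow> carrier_vec n" using S v by auto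
    have dim: "dim_vec ?w = n" using finsum_vec_closed[OF car] by auto
    have "?w $ j = (\<Sum>i\<in>S. a i * v i $ j)" if j: "j < n" for j
      unfolding index_finsum_vec[OF fin j car]
    proof (rule sum.cong[OF refl])
      fix i assume "i \<in> S"
      then have "dim_vec (v i) = n" using S v by auto
      then show "(a i \<cdot>\<^sub>v v i) $ j = a i * v i $ j" using j by simp
    qed
    then show ?thesis using dim by (auto simp: vec_eq_iff)
  qed
  have "elt_lin_dep n v I \<longleftrightarrow>
      (\<forall>g. (\<forall>j<r. g j < n) \<longrightarrow> layer (edet r (\<lambda>i j. v (e i) $ g j)) = 0)"
  proof
    assume "elt_lin_dep n v I"
    then obtain S a where all: "finite S \<and> S \<noteq> {} \<and> S \<subseteq> I \<and> (\<forall>i\<in>S. a i \<in> elt_times_set) \<and>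
        map_vec layer (finsum_vec TYPE('f elt) n (\<lambda>i. a i \<cdot>\<^sub>v v i) S) = 0\<^sub>v n"
      unfolding elt_lin_dep_def by (elim exE)
    then have S: "S \<noteq> {}" "S \<subseteq> I" "\<forall>i\<in>S. layer (a i) \<noteq> 0"
      unfolding elt_times_set_iff by simp_all
    have dep: "\<forall>j<n. layer (\<Sum>i\<in>S. a i * v i $ j) = 0"
      using all comb[OF S(2), of a] by simp
    show "\<forall>g. (\<forall>j<r. g j < n) \<longrightarrow> layer (edet r (\<lambda>i j. v (e i) $ g j)) = 0"
    proof (intro allI impI)
      fix g :: "nat \<Rightarrow> nat" assume g: "\<forall>j<r. g j < n"
      let ?x = "\<lambda>i. if e i \<in> S then a (e i) else 0"
      obtain s where "s \<in> S" using S(1) by blast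
      then obtain i0 where i0: "i0 < r" "e i0 \<in> S" using e S(2) by (auto simp: bij_betw_def)
      show "layer (edet r (\<lambda>i j. v (e i) $ g j)) = 0"
      proof (rule dependent_rows_singular[where x = ?x and ?i0.0 = i0])
        fix j assume "j < r"
        have "(\<Sum>i<r. ?x i * v (e i) $ g j) =
            (\<Sum>s\<in>I. (if s \<in> S then a s else 0) * v s $ g j)"
          by (rule sum.reindex_bij_betw[OF e])
        also have "\<dots> = (\<Sum>s\<in>S. (if s \<in> S then a s else 0) * v s $ g j)"
          by (rule sum.mono_neutral_right[OF finI S(2)]) auto
        also have "\<dots> = (\<Sum>s\<in>S. a s * v s $ g j)" by (rule sum.cong) auto
        finally show "layer (\<Sum>i<r. ?x i * v (e i) $ g j) = 0"
          using dep g \<open>j < r\<close> by simp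
      qed (use i0 S(3) in auto)
    qed
  next
    assume sing: "\<forall>g. (\<forall>j<r. g j < n) \<longrightarrow> layer (edet r (\<lambda>i j. v (e i) $ g j)) = 0"
    have "\<exists>x. (\<forall>i<r. x i = 0 \<or> layer (x i) \<noteq> 0) \<and> (\<exists>i<r. x i \<noteq> 0) \<and>
        (\<forall>j\<in>{..<n}. layer (\<Sum>i<r. x i * v (e i) $ j) = 0)"
      by (rule dependent_rows_if_minors_singular) (use sing in auto)
    then obtain x where "(\<forall>i<r. x i = 0 \<or> layer (x i) \<noteq> 0) \<and> (\<exists>i<r. x i \<noteq> 0) \<and>
        (\<forall>j\<in>{..<n}. layer (\<Sum>i<r. x i * v (e i) $ j) = 0)" ..
    then have x: "\<forall>i<r. x i = 0 \<or> layer (x i) \<noteq> 0" "\<exists>i<r. x i \<noteq> 0"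
      "\<forall>j\<in>{..<n}. layer (\<Sum>i<r. x i * v (e i) $ j) = 0" by simp_all
    define a where "a = (\<lambda>s. x (inv_into {..<r} e s))"
    have ae: "a (e i) = x i" if "i < r" for i
      using e that by (simp add: a_def bij_betw_def inv_into_f_f)
    define S where "S = {s \<in> I. a s \<noteq> 0}"
    have "S \<noteq> {}" using x(2) eI ae unfolding S_def by force
    moreover have S: "S \<subseteq> I" unfolding S_def by blast
    moreover have "layer (a s) \<noteq> 0" if s: "s \<in> S" for s
    proof -
      have "s \<in> e ` {..<r}" "a s \<noteq> 0" using s e unfolding S_def bij_betw_def by auto
      then obtain i where "i < r" "s = e i" by blast
      then show ?thesis using \<open>a s \<noteq> 0\<close> x(1) ae by auto
    qed
    moreover have "layer (\<Sum>s\<in>S. a s * v s $ j) = 0" if j: "j < n" for j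
    proof -
      have "(\<Sum>s\<in>S. a s * v s $ j) = (\<Sum>s\<in>I. a s * v s $ j)"
        by (rule sum.mono_neutral_left[OF finI]) (auto simp: S_def)
      also have "\<dots> = (\<Sum>i<r. a (e i) * v (e i) $ j)"
        by (rule sum.reindex_bij_betw[OF e, symmetric])
      also have "\<dots> = (\<Sum>i<r. x i * v (e i) $ j)"
        by (rule sum.cong) (simp_all add: ae)
      finally show ?thesis using x(3) j by simp
    qed
    moreover have "finite S" using finI unfolding S_def by simp
    ultimately show "elt_lin_dep n v I"
      unfolding elt_lin_dep_def elt_times_set_iff
      by (intro exI[of _ S] exI[of _ a] conjI) (simp_all add: comb[OF S])
  qed
  then show ?thesis by blast
qed

lemma cards_of_independent_families:
  fixes v :: "nat \<Rightarrow> 'f::field elt vec"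
  assumes v: "\<And>i. i < N \<Longrightarrow> v i \<in> carrier_vec n"
  shows "{card I | I. I \<subseteq> {0..<N} \<and> \<not> elt_lin_dep n v I} =
    {r. \<exists>f g. (\<forall>i<r. f i < N) \<and> (\<forall>j<r. g j < n) \<and> layer (edet r (\<lambda>i j. v (f i) $ g j)) \<noteq> 0}"
    (is "?L = ?R")
proof (intro equalityI subsetI)
  fix r assume "r \<in> ?L"
  then obtain I where I: "r = card I" "I \<subseteq> {0..<N}" "\<not> elt_lin_dep n v I" by blast
  have "finite I" using I(2) by (rule finite_subset) simp
  then obtain e where e: "bij_betw e {..<r} I"
    using ex_bij_betw_nat_finite I(1) by (auto simp: atLeast0LessThan)
  have "v i \<in> carrier_vec n" if "i \<in> I" for i using that I(2) v by auto
  then obtain g where "\<forall>j<r. g j < n" "layer (edet r (\<lambda>i j. v (e i) $ g j)) \<noteq> 0"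
    using I(3) independent_iff_nonsingular_minor[OF e] by blast
  moreover have "\<forall>i<r. e i < N" using e I(2) by (auto simp: bij_betw_def)
  ultimately show "r \<in> ?R" by blast
next
  fix r assume "r \<in> ?R"
  then obtain f g where f: "\<forall>i<r. f i < N" and g: "\<forall>j<r. g j < n"
    and ns: "layer (edet r (\<lambda>i j. v (f i) $ g j)) \<noteq> 0"
    by blast
  have inj: "inj_on f {..<r}"
    by (rule edet_nonsingular_inj(1)[of r "\<lambda>i j. v i $ j" f g]) (rule ns)
  then have e: "bij_betw f {..<r} (f ` {..<r})" by (simp add: bij_betw_def)
  have sub: "f ` {..<r} \<subseteq> {0..<N}" using f by auto
  then have "v i \<in> carrier_vec n" if "i \<in> f ` {..<r}" for i using that v by auto
  then have "\<not> elt_lin_dep n v (f ` {..<r})"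
    using g ns independent_iff_nonsingular_minor[OF e] by blast
  moreover have "card (f ` {..<r}) = r" using inj by (simp add: card_image)
  ultimately show "r \<in> ?L" using sub by (intro CollectI exI[of _ "f ` {..<r}"] conjI) simp_all
qed

lemma cards_of_independent_rows:
  fixes A :: "'f::field elt mat"
  shows "{card I | I. I \<subseteq> {0..<dim_row A} \<and> \<not> elt_lin_dep (dim_col A) (row A) I} =
    {r. has_nonsingular_minor A r}"
proof -
  have eq: "edet r (\<lambda>i j. row A (f i) $ g j) = edet r (\<lambda>i j. A $$ (f i, g j))"
    if "\<forall>i<r. f i < dim_row A" "\<forall>j<r. g j < dim_col A" for r f g
    by (rule edet_cong) (use that in simp)
  have "(\<exists>f g. (\<forall>i<r. f i < dim_row A) \<and> (\<forall>j<r. g j < dim_col A) \<and>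
      layer (edet r (\<lambda>i j. row A (f i) $ g j)) \<noteq> 0) \<longleftrightarrow> has_nonsingular_minor A r" for r
    unfolding has_nonsingular_minor_def by (simp add: eq cong: conj_cong)
  then show ?thesis by (subst cards_of_independent_families) simp_all
qed

lemma cards_of_independent_columns:
  fixes A :: "'f::field elt mat"
  shows "{card J | J. J \<subseteq> {0..<dim_col A} \<and> \<not> elt_lin_dep (dim_row A) (col A) J} =
    {r. has_nonsingular_minor A r}"
proof -
  have eq: "edet r (\<lambda>i j. col A (f i) $ g j) = edet r (\<lambda>i j. A $$ (g i, f j))"
    if "\<forall>i<r. f i < dim_col A" "\<forall>j<r. g j < dim_row A" for r f g
  proof -
    have "edet r (\<lambda>i j. col A (f i) $ g j) = edet r (\<lambda>i j. A $$ (g j, f i))"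
      by (rule edet_cong) (use that in simp)
    also have "\<dots> = edet r (\<lambda>i j. A $$ (g i, f j))" by (rule edet_transpose)
    finally show ?thesis .
  qed
  have "(\<exists>f g. (\<forall>i<r. f i < dim_col A) \<and> (\<forall>j<r. g j < dim_row A) \<and>
      layer (edet r (\<lambda>i j. col A (f i) $ g j)) \<noteq> 0) \<longleftrightarrow> has_nonsingular_minor A r" for r
  proof -
    have "has_nonsingular_minor A r \<longleftrightarrow> (\<exists>f g. (\<forall>i<r. f i < dim_col A) \<and> (\<forall>j<r. g j < dim_row A) \<and>
        layer (edet r (\<lambda>i j. A $$ (g i, f j))) \<noteq> 0)"
      unfolding has_nonsingular_minor_def by blast
    then show ?thesis by (simp add: eq cong: conj_cong)
  qed
  then show ?thesis by (subst cards_of_independent_families) simp_all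
qed

lemma nonsingular_if_columns_permuted:
  fixes b :: "nat \<Rightarrow> 'c \<Rightarrow> 'f::field elt"
  assumes f: "bij_betw f {..<r} J" and g: "bij_betw g {..<r} J"
    and ns: "layer (edet r (\<lambda>i j. b i (g j))) \<noteq> 0"
  shows "layer (edet r (\<lambda>i j. b i (f j))) \<noteq> 0"
proof -
  define q where "q = (\<lambda>j. if j < r then inv_into {..<r} g (f j) else j)"
  have "bij_betw (inv_into {..<r} g \<circ> f) {..<r} {..<r}"
    by (rule bij_betw_trans[OF f bij_betw_inv_into[OF g]])
  then have "bij_betw q {..<r} {..<r}"
    by (rule bij_betw_cong[THEN iffD1, rotated]) (simp add: q_def)
  then have q: "q permutes {0..<r}"
    unfolding atLeast0LessThan by (rule bij_imp_permutes) (simp add: q_def)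
  have gq: "g (q j) = f j" if "j < r" for j
  proof -
    have "f j \<in> g ` {..<r}" using f g that by (auto simp: bij_betw_def)
    then show ?thesis using that by (simp add: q_def f_inv_into_f)
  qed
  have "edet r (\<lambda>i j. b i (f j)) = edet r (\<lambda>i j. b i (g (q j)))"
    by (rule edet_cong) (simp add: gq)
  also have "\<dots> = Elt (of_int (sign q)) 0 * edet r (\<lambda>i j. b i (g j))"
    by (rule edet_permute_columns[OF q])
  finally show ?thesis using ns by (simp add: layer_mult sign_def)
qed

lemma bij_betw_pick:
  assumes "finite I"
  shows "bij_betw (pick I) {..<card I} I"
proof -
  have inj: "inj_on (pick I) {..<card I}"
    by (rule linorder_inj_onI) (auto dest: pick_mono_le)
  have "pick I ` {..<card I} \<subseteq> I" using pick_in_set_le by auto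
  then have "pick I ` {..<card I} = I"
    using assms inj by (intro card_subset_eq) (simp_all add: card_image)
  then show ?thesis using inj by (simp add: bij_betw_def)
qed

lemma nonsingular_submatrix_sizes:
  fixes A :: "'f::field elt mat"
  shows "insert 0 {r. 0 < r \<and> (\<exists>I J. I \<subseteq> {0..<dim_row A} \<and> J \<subseteq> {0..<dim_col A} \<and>
      card I = r \<and> card J = r \<and> \<not> elt_singular (submatrix A I J))} =
    {r. has_nonsingular_minor A r}"
proof -
  have sub: "elt_det (submatrix A I J) = edet r (\<lambda>i j. A $$ (pick I i, pick J j))"
    if "I \<subseteq> {0..<dim_row A}" "J \<subseteq> {0..<dim_col A}" "card I = r" "card J = r" for I J r
  proof -
    have "{i. i < dim_row A \<and> i \<in> I} = I" "{j. j < dim_col A \<and> j \<in> J} = J"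
      using that by auto
    then show ?thesis using that unfolding submatrix_def by simp
  qed
  have "has_nonsingular_minor A 0"
    by (simp add: has_nonsingular_minor_def edet_expand)
  moreover have "has_nonsingular_minor A r \<longleftrightarrow> (\<exists>I J. I \<subseteq> {0..<dim_row A} \<and> J \<subseteq> {0..<dim_col A} \<and>
      card I = r \<and> card J = r \<and> \<not> elt_singular (submatrix A I J))" for r
  proof
    assume "has_nonsingular_minor A r"
    then obtain f g where f: "\<forall>i<r. f i < dim_row A" and g: "\<forall>j<r. g j < dim_col A"
      and ns: "layer (edet r (\<lambda>i j. A $$ (f i, g j))) \<noteq> 0"
      unfolding has_nonsingular_minor_def by blast
    let ?I = "f ` {..<r}" and ?J = "g ` {..<r}"
    have inj: "inj_on f {..<r}" "inj_on g {..<r}"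
      using edet_nonsingular_inj[of r "\<lambda>i j. A $$ (i, j)" f g] ns by auto
    then have card: "card ?I = r" "card ?J = r" by (simp_all add: card_image)
    have "bij_betw f {..<r} ?I" "bij_betw g {..<r} ?J" using inj by (simp_all add: bij_betw_def)
    moreover have pick: "bij_betw (pick ?I) {..<r} ?I" "bij_betw (pick ?J) {..<r} ?J"
      using bij_betw_pick[of ?I] bij_betw_pick[of ?J] card by simp_all
    ultimately have "layer (edet r (\<lambda>i j. A $$ (f i, pick ?J j))) \<noteq> 0"
      using nonsingular_if_columns_permuted[where b = "\<lambda>i j. A $$ (f i, j)"] ns by blast
    then have "layer (edet r (\<lambda>i j. A $$ (f j, pick ?J i))) \<noteq> 0"
      using edet_transpose[of r "\<lambda>i j. A $$ (f i, pick ?J j)"] by simp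
    then have "layer (edet r (\<lambda>i j. A $$ (pick ?I j, pick ?J i))) \<noteq> 0"
      using nonsingular_if_columns_permuted[where b = "\<lambda>i j. A $$ (j, pick ?J i)"]
        pick(1) \<open>bij_betw f {..<r} ?I\<close> by blast
    then have "layer (edet r (\<lambda>i j. A $$ (pick ?I i, pick ?J j))) \<noteq> 0"
      using edet_transpose[of r "\<lambda>i j. A $$ (pick ?I i, pick ?J j)"] by simp
    moreover have "?I \<subseteq> {0..<dim_row A}" "?J \<subseteq> {0..<dim_col A}" using f g by auto
    ultimately show "\<exists>I J. I \<subseteq> {0..<dim_row A} \<and> J \<subseteq> {0..<dim_col A} \<and>
        card I = r \<and> card J = r \<and> \<not> elt_singular (submatrix A I J)"
      using card by (intro exI[of _ ?I] exI[of _ ?J]) (simp add: elt_singular_def sub)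
  next
    assume "\<exists>I J. I \<subseteq> {0..<dim_row A} \<and> J \<subseteq> {0..<dim_col A} \<and>
        card I = r \<and> card J = r \<and> \<not> elt_singular (submatrix A I J)"
    then obtain I J where IJ: "I \<subseteq> {0..<dim_row A}" "J \<subseteq> {0..<dim_col A}" "card I = r" "card J = r"
      and ns: "\<not> elt_singular (submatrix A I J)" by blast
    have "pick I i < dim_row A" "pick J i < dim_col A" if "i < r" for i
      using pick_in_set_le[of i I] pick_in_set_le[of i J] IJ that by auto
    then show "has_nonsingular_minor A r"
      using ns unfolding elt_singular_def sub[OF IJ] has_nonsingular_minor_def
      by (intro exI[of _ "pick I"] exI[of _ "pick J"]) simp
  qed
  ultimately show ?thesis by auto
qed

theorem theorem2p20:
  fixes A :: "'f::alg_closed_field elt mat"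
  assumes "A \<in> carrier_mat m n"
  shows "elt_row_rank A = elt_col_rank A \<and> elt_row_rank A = elt_submatrix_rank A"
  unfolding elt_row_rank_def elt_col_rank_def elt_submatrix_rank_def
    cards_of_independent_rows cards_of_independent_columns nonsingular_submatrix_sizes
  by simp

end
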